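(* There is a randomized algorithm that, given integer parameters $k \geq 0$ and $\Delta \geq 1$, a probability parameter $p < 1$, a starting vertex $s$, and query access (in the incidence-lists model) to a directed graph $G=(V,E)$, performs $O\big((k^2+1)\Delta\log(\tfrac{1}{1-p})\big)$ queries and returns a set of vertices $U$ such that (1) if there is a $k$-vertex-out component containing $s$ of volume at most $\Delta$ in $G$, then $U \supseteq \{s\}$ with probability at least $p$, and (2) if $U \supseteq \{s\}$, then $U$ is a $k$-vertex-out component of volume at most $O((k+1)(\Delta+k))$ in $G$. The same holds with "volume" replaced by "symmetric volume" in both (1) and (2). If every query to the graph can be performed in expected constant time, then the running time of the algorithm is $O\big((k^2+1)(\Delta+k)\log(\tfrac{1}{1-p})\big)$.
   Context: Incidence-lists query model: in one query the algorithm may ask, for any vertex $v$ and integer $i\ge1$, for the $i$-th outgoing or the $i$-th incoming edge of $v$ ($\bot$ if none). For $A,B\subseteq V$ let $E(A,B)=E\cap(A\times B)$. A $k$-vertex-out component of $G$ is a non-empty $C\subseteq V$ such that $B=\{v\in V\setminus C:\exists (u,v)\in E, u\in C\}$ satisfies $|B|\le k$. The volume of $C$ is $\operatorname{vol}(C)=|E(C,V)|$ and the symmetric volume is $\operatorname{vol}^*(C)=|E(C,V)\cup E(V,C)|$.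
   Formalization: In both complexity bounds the factor log(1/(1-p)) is read as max(1, ln(1/(1-p))), since for p near or below 0 the literal bound would allow no query or step at all, which makes the claim false. *)

theory Defs
  imports "HOL-Probability.Probability" "Graph_Theory.Pair_Digraph"
begin

section \<open>Vertex-out components and volumes\<close>

text \<open>
  A directed graph is a \<^typ>\<open>'a pair_pre_digraph\<close> satisfying \<^locale>\<open>pair_fin_digraph\<close>: a finite
  vertex set and a set of ordered pairs of vertices. Self-loops are allowed.
\<close>

definition arcs_between :: "'a pair_pre_digraph \<Rightarrow> 'a set \<Rightarrow> 'a set \<Rightarrow> ('a \<times> 'a) set" where
  "arcs_between G A B = parcs G \<inter> (A \<times> B)"

definition vertex_out_component :: "'a pair_pre_digraph \<Rightarrow> nat \<Rightarrow> 'a set \<Rightarrow> bool" where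
  "vertex_out_component G k C \<longleftrightarrow>
     C \<noteq> {} \<and> C \<subseteq> pverts G \<and>
     card {v \<in> pverts G - C. \<exists>u\<in>C. (u, v) \<in> parcs G} \<le> k"

definition volume :: "'a pair_pre_digraph \<Rightarrow> 'a set \<Rightarrow> nat" where
  "volume G C = card (arcs_between G C (pverts G))"

definition sym_volume :: "'a pair_pre_digraph \<Rightarrow> 'a set \<Rightarrow> nat" where
  "sym_volume G C = card (arcs_between G C (pverts G) \<union> arcs_between G (pverts G) C)"


section \<open>The incidence-lists query model\<close>

text \<open>Vertices are natural numbers, so that a vertex fits into one memory cell of the machine below.\<close>

datatype dir = Out | In

type_synonym query = "dir \<times> nat \<times> nat"

type_synonym inc_lists = "dir \<Rightarrow> nat \<Rightarrow> (nat \<times> nat) list"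

text \<open>The order of each list is arbitrary (chosen by an adversary, but fixed).\<close>

definition incidence_lists :: "nat pair_pre_digraph \<Rightarrow> inc_lists \<Rightarrow> bool" where
  "incidence_lists G L \<longleftrightarrow>
     (\<forall>v. distinct (L Out v) \<and> set (L Out v) = {e \<in> parcs G. fst e = v} \<and>
          distinct (L In v) \<and> set (L In v) = {e \<in> parcs G. snd e = v})"

text \<open>Indices start at 1; \<^term>\<open>None\<close> is the answer if there is no such edge.\<close>

fun answer :: "inc_lists \<Rightarrow> query \<Rightarrow> (nat \<times> nat) option" where
  "answer L (d, v, i) =
     (if 1 \<le> i \<and> i \<le> length (L d v) then Some (L d v ! (i - 1)) else None)"

definition legal_queries :: "nat pair_pre_digraph \<Rightarrow> query set" where
  "legal_queries G = {(d, v, i). v \<in> pverts G \<and> 1 \<le> i}"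


section \<open>Randomized random-access programs with graph queries\<close>

text \<open>
  Algorithms are finite programs for a unit-cost random access machine. The memory consists of
  arrays of natural numbers (a scalar is cell 0 of an array) and of real registers. The latter are
  present only because the probability parameter is an arbitrary real number. Multiplication,
  division, bit operations and rounding are deliberately not primitive: with unbounded cells
  they would make the unit-cost measure unreasonable. Subtraction on naturals is truncated.
\<close>

type_synonym vname = string

datatype aexp = N nat | Elem vname aexp | Plus aexp aexp | Minus aexp aexp

datatype rexp = R vname | ROne | RPlus rexp rexp | RMinus rexp rexp

datatype bexp = Less aexp aexp | RLess rexp rexp | Neg bexp | Conj bexp bexp

datatype com =
    Skip
  | Assign vname aexp aexp
  | RAssign vname rexp
  | Rand vname aexp
  | Query dir aexp aexp vname vname vname
  | Seq com com
  | If bexp com com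
  | While bexp com

text \<open>
  Besides the memory, a state records the list of queries made so far (oldest first)
  and the number of elementary steps executed so far.
\<close>

record state =
  mem :: "vname \<Rightarrow> nat \<Rightarrow> nat"
  rmem :: "vname \<Rightarrow> real"
  queries :: "query list"
  steps :: nat

primrec aval :: "aexp \<Rightarrow> state \<Rightarrow> nat" where
  "aval (N n) \<sigma> = n"
| "aval (Elem x a) \<sigma> = mem \<sigma> x (aval a \<sigma>)"
| "aval (Plus a b) \<sigma> = aval a \<sigma> + aval b \<sigma>"
| "aval (Minus a b) \<sigma> = aval a \<sigma> - aval b \<sigma>"

primrec rval :: "rexp \<Rightarrow> state \<Rightarrow> real" where
  "rval (R x) \<sigma> = rmem \<sigma> x"
| "rval ROne \<sigma> = 1"
| "rval (RPlus a b) \<sigma> = rval a \<sigma> + rval b \<sigma>"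
| "rval (RMinus a b) \<sigma> = rval a \<sigma> - rval b \<sigma>"

primrec bval :: "bexp \<Rightarrow> state \<Rightarrow> bool" where
  "bval (Less a b) \<sigma> \<longleftrightarrow> aval a \<sigma> < aval b \<sigma>"
| "bval (RLess a b) \<sigma> \<longleftrightarrow> rval a \<sigma> < rval b \<sigma>"
| "bval (Neg b) \<sigma> \<longleftrightarrow> \<not> bval b \<sigma>"
| "bval (Conj b c) \<sigma> \<longleftrightarrow> bval b \<sigma> \<and> bval c \<sigma>"

definition tick :: "state \<Rightarrow> state" where
  "tick \<sigma> = \<sigma>\<lparr>steps := Suc (steps \<sigma>)\<rparr>"

definition store :: "vname \<Rightarrow> nat \<Rightarrow> nat \<Rightarrow> state \<Rightarrow> state" where
  "store x i n \<sigma> = \<sigma>\<lparr>mem := (mem \<sigma>)(x := (mem \<sigma> x)(i := n))\<rparr>"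

text \<open>
  The answer to a query is stored in three scalars: \<open>b\<close> tells whether the edge exists,
  and if so, \<open>x\<close> and \<open>y\<close> receive its tail and its head.
\<close>

definition ask ::
    "inc_lists \<Rightarrow> query \<Rightarrow> vname \<Rightarrow> vname \<Rightarrow> vname \<Rightarrow> state \<Rightarrow> state" where
  "ask L q b x y \<sigma> =
     (case answer L q of
        None \<Rightarrow> store b 0 0 \<sigma>
      | Some (u, v) \<Rightarrow> store y 0 v (store x 0 u (store b 0 1 \<sigma>)))
     \<lparr>queries := queries \<sigma> @ [q]\<rparr>"

partial_function (spmf) while_spmf :: "('s \<Rightarrow> bool) \<Rightarrow> ('s \<Rightarrow> 's spmf) \<Rightarrow> 's \<Rightarrow> 's spmf" where
  "while_spmf b f \<sigma> =
     (if b \<sigma> then bind_spmf (f \<sigma>) (while_spmf b f) else return_spmf \<sigma>)"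

text \<open>
  The distribution of the final state; probability mass that is missing belongs to
  non-terminating runs. Every executed instruction and every evaluated test costs one step. As a
  program is a fixed finite text, charging for the size of expressions would only change constants.
  \<open>Rand x a\<close> draws a uniformly random element of \<open>{0..n}\<close>, where \<open>n\<close> is the value of \<open>a\<close>.
\<close>

primrec exec :: "inc_lists \<Rightarrow> com \<Rightarrow> state \<Rightarrow> state spmf" where
  "exec L Skip \<sigma> = return_spmf (tick \<sigma>)"
| "exec L (Assign x a b) \<sigma> = return_spmf (tick (store x (aval a \<sigma>) (aval b \<sigma>) \<sigma>))"
| "exec L (RAssign x a) \<sigma> = return_spmf (tick (\<sigma>\<lparr>rmem := (rmem \<sigma>)(x := rval a \<sigma>)\<rparr>))"
| "exec L (Rand x a) \<sigma> =
     map_spmf (\<lambda>n. tick (store x 0 n \<sigma>)) (spmf_of_set {0..aval a \<sigma>})"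
| "exec L (Query d a i b x y) \<sigma> =
     return_spmf (tick (ask L (d, aval a \<sigma>, aval i \<sigma>) b x y \<sigma>))"
| "exec L (Seq c c') \<sigma> = bind_spmf (exec L c \<sigma>) (exec L c')"
| "exec L (If b c c') \<sigma> = (if bval b \<sigma> then exec L c (tick \<sigma>) else exec L c' (tick \<sigma>))"
| "exec L (While b c) \<sigma> = map_spmf tick (while_spmf (bval b) (\<lambda>\<sigma>. exec L c (tick \<sigma>)) \<sigma>)"

text \<open>
  All memory cells except those holding the parameters are initially 0. The program knows
  the graph only through its queries.
\<close>

definition init :: "nat \<Rightarrow> nat \<Rightarrow> real \<Rightarrow> nat \<Rightarrow> state" where
  "init k \<Delta> p s =
     \<lparr>mem = (\<lambda>x i. 0)(''k'' := (\<lambda>i. 0)(0 := k), ''Delta'' := (\<lambda>i. 0)(0 := \<Delta>),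
                      ''s'' := (\<lambda>i. 0)(0 := s)),
      rmem = (\<lambda>x. 0)(''p'' := p), queries = [], steps = 0\<rparr>"

definition run :: "com \<Rightarrow> inc_lists \<Rightarrow> nat \<Rightarrow> nat \<Rightarrow> real \<Rightarrow> nat \<Rightarrow> state spmf" where
  "run P L k \<Delta> p s = exec L P (init k \<Delta> p s)"

text \<open>The returned set is listed in the array \<open>U\<close>, with its length (counting repetitions) in \<open>n\<close>.\<close>

definition returned_set :: "state \<Rightarrow> nat set" where
  "returned_set \<sigma> = {mem \<sigma> ''U'' i | i. i < mem \<sigma> ''n'' 0}"


section \<open>Running time with randomized query times\<close>

text \<open>
  A cost function \<open>f\<close> assigns to a non-empty list of queries the time needed for its last query,
  when the preceding ones were made before. The implementation of the queries is
  a random cost function, i.e. a probability measure on cost functions, which is independent of the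
  random choices of the program. Expected constant time means that for every
  history the expected time of the last query is bounded by a constant \<open>\<tau>\<close>. Fresh random times
  for every query are covered, and so are costs that all depend on one initial random choice,
  such as a hash function.
\<close>

definition expected_query_time_le ::
    "nat pair_pre_digraph \<Rightarrow> real \<Rightarrow> (query list \<Rightarrow> ennreal) measure \<Rightarrow> bool" where
  "expected_query_time_le G \<tau> M \<longleftrightarrow>
     prob_space M \<and>
     (\<forall>h. h \<noteq> [] \<and> set h \<subseteq> legal_queries G \<longrightarrow>
        (\<lambda>f. f h) \<in> borel_measurable M \<and> (\<integral>\<^sup>+ f. f h \<partial>M) \<le> ennreal \<tau>)"

definition time :: "(query list \<Rightarrow> ennreal) \<Rightarrow> state \<Rightarrow> ennreal" where
  "time f \<sigma> = of_nat (steps \<sigma>) + (\<Sum>j<length (queries \<sigma>). f (take (Suc j) (queries \<sigma>)))"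

definition expected_time :: "(query list \<Rightarrow> ennreal) measure \<Rightarrow> state spmf \<Rightarrow> ennreal" where
  "expected_time M r = (\<integral>\<^sup>+ f. (\<integral>\<^sup>+ \<sigma>. time f \<sigma> \<partial>measure_spmf r) \<partial>M)"


section \<open>The dependence on the success probability\<close>

text \<open>
  The factor \<open>log (1 / (1 - p))\<close> of the complexity bounds tends to 0 for \<open>p \<rightarrow> 0\<close> and is negative
  for \<open>p < 0\<close>, whereas every algorithm needs at least one step, and at least one query if it is to
  succeed with positive probability. As usual, the factor is read as being at least 1.
\<close>

definition log_factor :: "real \<Rightarrow> real" where
  "log_factor p = max 1 (ln (1 / (1 - p)))"

end

theory Submission
  imports Defs
begin

text \<open>
  Write \<open>cl X\<close> for \<open>X\<close> together with the heads of its outgoing edges. A family of vertex-disjoint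
  paths starting at \<open>s\<close> is encoded by a map \<open>g\<close> on the vertices with \<open>w \<in> cl {g w}\<close>: \<open>g w\<close> is the
  predecessor of \<open>w\<close> on its path, or \<open>w\<close> itself if no path passes through \<open>w\<close>. The residual graph then
  has an edge from \<open>u\<close> to \<open>g w\<close> for every \<open>w \<in> cl {u}\<close>, and augmenting along a path of it from \<open>s\<close> to
  \<open>t\<close> changes the load \<open>card {w. g w \<in> X}\<close> by \<open>+ 1\<close> if \<open>s \<in> X\<close> and by \<open>- 1\<close> if \<open>t \<in> X\<close>, starting
  from \<open>card X\<close>. If \<open>X\<close> is closed in the residual graph after at most \<open>k\<close> augmentations, then
  \<open>card (cl X)\<close> is at most the load of \<open>X\<close>, hence at most \<open>card X + k\<close>, so \<open>X\<close> is a \<open>k\<close>-vertex-out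
  component.

  The program searches the residual graph from \<open>s\<close> until it is exhausted or \<open>O((k + 1) \<Delta>)\<close> edges have
  been seen. In the latter case it augments along the search path to the vertex of a random edge. If
  a component \<open>C\<close> of volume at most \<open>\<Delta>\<close> exists, this vertex lies outside \<open>C\<close> with probability
  at least \<open>1 - 1 / (2 k + 1)\<close>, and since the load of \<open>C\<close> is at most \<open>card (cl C) \<le> card C + k\<close>, after \<open>k\<close> such
  augmentations \<open>C\<close> is closed and the search is exhausted. Thus \<open>k + 1\<close> rounds fail with
  probability at most \<open>1 / 2\<close>, and \<open>O(log (1 / (1 - p)))\<close> repetitions suffice.
\<close>

section \<open>Reasoning about programs\<close>

text \<open>A weakest precondition for total correctness: losslessness stands for almost sure
  termination. Costs may be part of \<open>Q\<close>, so they are bounded in every run of positive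
  probability and not merely on average.\<close>

definition ok :: "inc_lists \<Rightarrow> com \<Rightarrow> state \<Rightarrow> (state \<Rightarrow> bool) \<Rightarrow> bool" where
  "ok L c \<sigma> Q \<longleftrightarrow> lossless_spmf (exec L c \<sigma>) \<and> (\<forall>\<sigma>'\<in>set_spmf (exec L c \<sigma>). Q \<sigma>')"

text \<open>The quantitative counterpart of \<open>ok\<close>, a weakest pre-expectation. It serves
  to bound failure probabilities.\<close>

definition expect :: "inc_lists \<Rightarrow> com \<Rightarrow> (state \<Rightarrow> ennreal) \<Rightarrow> state \<Rightarrow> ennreal" where
  "expect L c f \<sigma> = (\<integral>\<^sup>+ \<sigma>'. f \<sigma>' \<partial>measure_spmf (exec L c \<sigma>))"

lemma mem_tick [simp]: "mem (tick \<sigma>) = mem \<sigma>"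
  and rmem_tick [simp]: "rmem (tick \<sigma>) = rmem \<sigma>"
  and queries_tick [simp]: "queries (tick \<sigma>) = queries \<sigma>"
  and steps_tick [simp]: "steps (tick \<sigma>) = Suc (steps \<sigma>)"
  by (simp_all add: tick_def)

lemma mem_store [simp]:
    "mem (store x i n \<sigma>) y = (if y = x then (mem \<sigma> y)(i := n) else mem \<sigma> y)"
  and rmem_store [simp]: "rmem (store x i n \<sigma>) = rmem \<sigma>"
  and queries_store [simp]: "queries (store x i n \<sigma>) = queries \<sigma>"
  and steps_store [simp]: "steps (store x i n \<sigma>) = steps \<sigma>"
  by (simp_all add: store_def)

lemma ask_hit:
  assumes "1 \<le> i" "i \<le> length (L d v)"
  shows "ask L (d, v, i) b x y \<sigma> =
    (store y 0 (snd (L d v ! (i - 1))) (store x 0 (fst (L d v ! (i - 1))) (store b 0 1 \<sigma>)))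
      \<lparr>queries := queries \<sigma> @ [(d, v, i)]\<rparr>"
  using assms by (simp add: ask_def case_prod_unfold)

lemma ask_miss:
  assumes "length (L d v) < i"
  shows "ask L (d, v, i) b x y \<sigma> = (store b 0 0 \<sigma>)\<lparr>queries := queries \<sigma> @ [(d, v, i)]\<rparr>"
  using assms by (simp add: ask_def)

lemma ok_mono: "ok L c \<sigma> Q \<Longrightarrow> (\<And>\<sigma>'. Q \<sigma>' \<Longrightarrow> Q' \<sigma>') \<Longrightarrow> ok L c \<sigma> Q'"
  by (auto simp: ok_def)

lemma ok_simps [simp]:
  "ok L Skip \<sigma> Q \<longleftrightarrow> Q (tick \<sigma>)"
  "ok L (Assign x a e) \<sigma> Q \<longleftrightarrow> Q (tick (store x (aval a \<sigma>) (aval e \<sigma>) \<sigma>))"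
  "ok L (RAssign x r) \<sigma> Q \<longleftrightarrow> Q (tick (\<sigma>\<lparr>rmem := (rmem \<sigma>)(x := rval r \<sigma>)\<rparr>))"
  "ok L (Rand x a) \<sigma> Q \<longleftrightarrow> (\<forall>n\<le>aval a \<sigma>. Q (tick (store x 0 n \<sigma>)))"
  "ok L (Query d a i b x y) \<sigma> Q \<longleftrightarrow> Q (tick (ask L (d, aval a \<sigma>, aval i \<sigma>) b x y \<sigma>))"
  "ok L (Seq c c') \<sigma> Q \<longleftrightarrow> ok L c \<sigma> (\<lambda>\<sigma>'. ok L c' \<sigma>' Q)"
  "ok L (If be c c') \<sigma> Q \<longleftrightarrow> (if bval be \<sigma> then ok L c (tick \<sigma>) Q else ok L c' (tick \<sigma>) Q)"
  by (auto simp: ok_def set_bind_spmf)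

lemma while_unfold:
  "exec L (While b c) \<sigma> =
    (if bval b \<sigma> then bind_spmf (exec L c (tick \<sigma>)) (exec L (While b c)) else return_spmf (tick \<sigma>))"
  by (subst exec.simps, subst while_spmf.simps)
    (auto simp: map_spmf_bind_spmf o_def intro!: bind_spmf_cong)

text \<open>The variant drops on every outcome of the body, so plain induction on it also yields
  termination, with no limit argument for the loop.\<close>

lemma ok_while:
  fixes m :: "state \<Rightarrow> nat"
  assumes "I \<sigma>"
    and step: "\<And>\<sigma>. I \<sigma> \<Longrightarrow> bval b \<sigma> \<Longrightarrow> ok L c (tick \<sigma>) (\<lambda>\<sigma>'. I \<sigma>' \<and> m \<sigma>' < m \<sigma>)"
    and exit: "\<And>\<sigma>. I \<sigma> \<Longrightarrow> \<not> bval b \<sigma> \<Longrightarrow> Q (tick \<sigma>)"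
  shows "ok L (While b c) \<sigma> Q"
  using \<open>I \<sigma>\<close>
proof (induction "m \<sigma>" arbitrary: \<sigma> rule: less_induct)
  case less
  show ?case
  proof (cases "bval b \<sigma>")
    case True
    have "ok L (While b c) \<sigma>' Q" if "\<sigma>' \<in> set_spmf (exec L c (tick \<sigma>))" for \<sigma>'
      using step[OF less.prems True] that less.hyps by (auto simp: ok_def)
    then show ?thesis
      using step[OF less.prems True] True
      by (subst ok_def, subst (1 2) while_unfold) (auto simp: ok_def set_bind_spmf)
  next
    case False
    then show ?thesis
      using exit[OF less.prems False] by (subst ok_def, subst (1 2) while_unfold) auto
  qed
qed

lemma nn_integral_bind_spmf:
  "(\<integral>\<^sup>+ x. f x \<partial>measure_spmf (bind_spmf p q)) = (\<integral>\<^sup>+ y. (\<integral>\<^sup>+ x. f x \<partial>measure_spmf (q y)) \<partial>measure_spmf p)"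
  unfolding measure_spmf_bind
  by (subst nn_integral_bind[where B = "count_space UNIV"]) (auto simp: o_def)

lemma expect_Seq: "expect L (Seq c c') f \<sigma> = expect L c (expect L c' f) \<sigma>"
  by (simp add: expect_def nn_integral_bind_spmf)

lemma expect_If: "expect L (If e c c') f \<sigma> = (if bval e \<sigma> then expect L c f (tick \<sigma>) else expect L c' f (tick \<sigma>))"
  by (simp add: expect_def)

lemma expect_Assign:
  "expect L (Assign x a b) f \<sigma> = f (tick (store x (aval a \<sigma>) (aval b \<sigma>) \<sigma>))"
  "expect L (RAssign y r) f \<sigma> = f (tick (\<sigma>\<lparr>rmem := (rmem \<sigma>)(y := rval r \<sigma>)\<rparr>))"
  by (simp_all add: expect_def measure_spmf_return_spmf nn_integral_return)

lemma expect_Rand: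
  "expect L (Rand x a) f \<sigma> = (\<Sum>n\<le>aval a \<sigma>. f (tick (store x 0 n \<sigma>))) / of_nat (Suc (aval a \<sigma>))"
  by (simp add: expect_def nn_integral_spmf_of_set atLeast0AtMost ennreal_of_nat_eq_real_of_nat)

lemma expect_mono:
  assumes "ok L c \<sigma> Q" "\<And>\<sigma>'. Q \<sigma>' \<Longrightarrow> f \<sigma>' \<le> g \<sigma>'"
  shows "expect L c f \<sigma> \<le> expect L c g \<sigma>"
  using assms by (auto simp: ok_def expect_def intro!: nn_integral_mono_AE)

lemma expect_le_const:
  assumes "ok L c \<sigma> Q" "\<And>\<sigma>'. Q \<sigma>' \<Longrightarrow> f \<sigma>' \<le> a"
  shows "expect L c f \<sigma> \<le> a"
proof -
  have "expect L c f \<sigma> \<le> expect L c (\<lambda>_. a) \<sigma>"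
    using assms by (rule expect_mono)
  also have "\<dots> = a * ennreal (weight_spmf (exec L c \<sigma>))"
    by (simp add: expect_def measure_spmf.emeasure_eq_measure space_measure_spmf weight_spmf_def)
  also have "\<dots> = a"
    using assms(1) by (simp add: ok_def lossless_spmf_def)
  finally show ?thesis .
qed

lemma expect_Seq_le:
  assumes "ok L c \<sigma> Q" "\<And>\<sigma>'. Q \<sigma>' \<Longrightarrow> expect L c' f \<sigma>' \<le> a"
  shows "expect L (Seq c c') f \<sigma> \<le> a"
  unfolding expect_Seq by (rule expect_le_const[OF assms])

lemma expect_cmult: "expect L c (\<lambda>\<sigma>. a * f \<sigma>) \<sigma> = a * expect L c f \<sigma>"
  by (simp add: expect_def nn_integral_cmult)

text \<open>The function \<open>\<phi>\<close> plays the role of a supermartingale.\<close>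

lemma expect_while:
  fixes m :: "state \<Rightarrow> nat"
  assumes "I \<sigma>"
    and step: "\<And>\<sigma>. I \<sigma> \<Longrightarrow> bval b \<sigma> \<Longrightarrow> ok L c (tick \<sigma>) (\<lambda>\<sigma>'. I \<sigma>' \<and> m \<sigma>' < m \<sigma>)"
    and le: "\<And>\<sigma>. I \<sigma> \<Longrightarrow> bval b \<sigma> \<Longrightarrow> expect L c \<phi> (tick \<sigma>) \<le> \<phi> \<sigma>"
    and exit: "\<And>\<sigma>. I \<sigma> \<Longrightarrow> \<not> bval b \<sigma> \<Longrightarrow> f (tick \<sigma>) \<le> \<phi> \<sigma>"
  shows "expect L (While b c) f \<sigma> \<le> \<phi> \<sigma>"
  using \<open>I \<sigma>\<close>
proof (induction "m \<sigma>" arbitrary: \<sigma> rule: less_induct)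
  case less
  show ?case
  proof (cases "bval b \<sigma>")
    case True
    have "expect L (While b c) f \<sigma> = expect L c (expect L (While b c) f) (tick \<sigma>)"
      unfolding expect_def by (subst while_unfold) (use True in \<open>simp add: nn_integral_bind_spmf del: exec.simps\<close>)
    also have "\<dots> \<le> expect L c \<phi> (tick \<sigma>)"
      using step[OF less.prems True] less.hyps by (rule expect_mono) auto
    also have "\<dots> \<le> \<phi> \<sigma>"
      by (rule le[OF less.prems True])
    finally show ?thesis .
  next
    case False
    then show ?thesis
      unfolding expect_def by (subst while_unfold) (use exit[OF less.prems False] in
        \<open>simp add: measure_spmf_return_spmf nn_integral_return del: exec.simps\<close>)
  qed
qed

text \<open>
  The number of queries in a run is bounded surely, so that by Fubini the randomness of the query
  times is averaged out for every fixed run.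
\<close>

lemma expected_time_le:
  assumes M: "expected_query_time_le G \<tau> M"
    and supp: "\<And>\<sigma>. \<sigma> \<in> set_spmf r \<Longrightarrow>
      set (queries \<sigma>) \<subseteq> legal_queries G \<and> length (queries \<sigma>) \<le> a \<and> steps \<sigma> \<le> b"
  shows "expected_time M r \<le> of_nat b + of_nat a * ennreal \<tau>"
proof -
  interpret M: prob_space M
    using M by (simp add: expected_query_time_le_def)
  have hist: "(\<lambda>f. f h) \<in> borel_measurable M \<and> (\<integral>\<^sup>+ f. f h \<partial>M) \<le> ennreal \<tau>"
    if "h \<noteq> []" "set h \<subseteq> legal_queries G" for h
    using M that by (simp add: expected_query_time_le_def)
  have pre: "take (Suc j) (queries \<sigma>) \<noteq> []" "set (take (Suc j) (queries \<sigma>)) \<subseteq> legal_queries G"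
    if "\<sigma> \<in> set_spmf r" "j < length (queries \<sigma>)" for \<sigma> j
    using supp[OF that(1)] that(2) by (auto dest: in_set_takeD)
  have meas: "(\<lambda>f. time f \<sigma>) \<in> borel_measurable M" if "\<sigma> \<in> set_spmf r" for \<sigma>
    unfolding time_def using hist pre[OF that] by (intro borel_measurable_add borel_measurable_sum) auto
  have time: "(\<integral>\<^sup>+ f. time f \<sigma> \<partial>M) \<le> of_nat b + of_nat a * ennreal \<tau>" if \<sigma>: "\<sigma> \<in> set_spmf r" for \<sigma>
  proof -
    have "(\<integral>\<^sup>+ f. time f \<sigma> \<partial>M) =
        of_nat (steps \<sigma>) + (\<Sum>j<length (queries \<sigma>). \<integral>\<^sup>+ f. f (take (Suc j) (queries \<sigma>)) \<partial>M)"
      unfolding time_def using hist pre[OF \<sigma>]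
      by (subst nn_integral_add)
        (auto simp: nn_integral_sum M.emeasure_space_1 intro!: borel_measurable_sum nn_integral_sum simp del: take_Suc)
    also have "\<dots> \<le> of_nat b + (\<Sum>j<length (queries \<sigma>). ennreal \<tau>)"
      using hist pre[OF \<sigma>] supp[OF \<sigma>] by (intro add_mono sum_mono) (auto simp: of_nat_mono)
    also have "\<dots> \<le> of_nat b + of_nat a * ennreal \<tau>"
      using supp[OF \<sigma>] by (auto intro!: add_mono mult_right_mono of_nat_mono)
    finally show ?thesis .
  qed
  \<comment> \<open>Measurability of \<open>time f \<sigma>\<close> is available only in
    \<open>f\<close>, for each single run. Integrating over the countable support of
    \<open>r\<close> allows the exchange without joint measurability.\<close>
  have "expected_time M r = (\<integral>\<^sup>+ f. (\<integral>\<^sup>+ \<sigma>. ennreal (spmf r \<sigma>) * time f \<sigma> \<partial>count_space (set_spmf r)) \<partial>M)"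
    unfolding expected_time_def
    by (intro nn_integral_cong) (auto simp: nn_integral_measure_spmf')
  also have "\<dots> = (\<integral>\<^sup>+ \<sigma>. (\<integral>\<^sup>+ f. ennreal (spmf r \<sigma>) * time f \<sigma> \<partial>M) \<partial>count_space (set_spmf r))"
    using meas by (intro nn_integral_count_space_nn_integral borel_measurable_times_ennreal) (auto simp: countable_set_spmf)
  also have "\<dots> = (\<integral>\<^sup>+ \<sigma>. ennreal (spmf r \<sigma>) * (\<integral>\<^sup>+ f. time f \<sigma> \<partial>M) \<partial>count_space (set_spmf r))"
    using meas by (intro nn_integral_cong) (auto simp: nn_integral_cmult)
  also have "\<dots> = (\<integral>\<^sup>+ \<sigma>. (\<integral>\<^sup>+ f. time f \<sigma> \<partial>M) \<partial>measure_spmf r)"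
    by (simp add: nn_integral_measure_spmf')
  also have "\<dots> \<le> (\<integral>\<^sup>+ \<sigma>. of_nat b + of_nat a * ennreal \<tau> \<partial>measure_spmf r)"
    using time by (intro nn_integral_mono_AE) auto
  also have "\<dots> \<le> (of_nat b + of_nat a * ennreal \<tau>) * 1"
    by (subst nn_integral_const) (intro mult_left_mono measure_spmf.subprob_emeasure_le_1, simp)
  finally show ?thesis by simp
qed

section \<open>Augmentations and searches\<close>

text \<open>\<open>both\<close> selects the symmetric volume, for which incoming lists are scanned
  as well.\<close>

locale listed_graph =
  fixes G :: "nat pair_pre_digraph" and L :: inc_lists and s :: nat and both :: bool
  assumes fin: "pair_fin_digraph G" and lists: "incidence_lists G L" and start: "s \<in> pverts G"
begin

abbreviation "V \<equiv> pverts G"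
abbreviation "E \<equiv> parcs G"

section \<open>Closures, degrees and volumes\<close>

definition cl :: "nat set \<Rightarrow> nat set" where
  "cl X = X \<union> {w. \<exists>u\<in>X. (u, w) \<in> E}"

definition vol :: "nat set \<Rightarrow> nat" where
  "vol = (if both then sym_volume G else volume G)"

text \<open>A maximum instead of a sum, since the two lists of a vertex are read in parallel, index
  by index.\<close>

definition deg :: "nat \<Rightarrow> nat" where
  "deg v = max (length (L Out v)) (if both then length (L In v) else 0)"

lemma finite_V [simp]: "finite V" and finite_E [simp]: "finite E"
  and arcD: "(u, w) \<in> E \<Longrightarrow> u \<in> V \<and> w \<in> V"
  using fin by (auto simp: pair_fin_digraph_def pair_fin_digraph_axioms_def dest: pair_wf_digraph.in_arcsD1 pair_wf_digraph.in_arcsD2)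

lemma set_L: "set (L Out v) = {e \<in> E. fst e = v}" "set (L In v) = {e \<in> E. snd e = v}"
  using lists by (simp_all add: incidence_lists_def)

lemma length_L: "length (L Out v) = card {e \<in> E. fst e = v}" "length (L In v) = card {e \<in> E. snd e = v}"
  using lists by (metis incidence_lists_def distinct_card)+

lemma finite_subset_V: "X \<subseteq> V \<Longrightarrow> finite X"
  by (rule finite_subset[OF _ finite_V])

lemma cl_subset: "X \<subseteq> V \<Longrightarrow> cl X \<subseteq> V"
  by (auto simp: cl_def dest: arcD)

lemma card_cl:
  assumes "X \<subseteq> V"
  shows "card (cl X) = card X + card {v \<in> V - X. \<exists>u\<in>X. (u, v) \<in> E}"
proof -
  have "cl X = X \<union> {v \<in> V - X. \<exists>u\<in>X. (u, v) \<in> E}"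
    by (auto simp: cl_def dest: arcD)
  moreover have "finite X"
    by (rule finite_subset_V[OF assms])
  ultimately show ?thesis
    by (simp add: card_Un_disjoint Int_def)
qed

lemma vertex_out_component_iff:
  "vertex_out_component G k X \<longleftrightarrow> X \<noteq> {} \<and> X \<subseteq> V \<and> card (cl X) \<le> card X + k"
  using card_cl[of X] by (auto simp: vertex_out_component_def)

lemma sum_length_L:
  assumes "finite X"
  shows "(\<Sum>v\<in>X. length (L Out v)) = card (arcs_between G X V)"
    "(\<Sum>v\<in>X. length (L In v)) = card (arcs_between G V X)"
proof -
  have "arcs_between G X V = (\<Union>v\<in>X. {e \<in> E. fst e = v})" "arcs_between G V X = (\<Union>v\<in>X. {e \<in> E. snd e = v})"
    by (auto simp: arcs_between_def dest: arcD)
  then show "(\<Sum>v\<in>X. length (L Out v)) = card (arcs_between G X V)"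
    "(\<Sum>v\<in>X. length (L In v)) = card (arcs_between G V X)"
    using assms by (auto simp: length_L intro!: card_UN_disjoint[symmetric])
qed

lemma finite_arcs_between [simp]: "finite (arcs_between G X Y)"
  by (simp add: arcs_between_def)

text \<open>The factor 2 is the price of the maximum in \<open>deg\<close>: a vertex has two lists
  of at most that length.\<close>

lemma vol_le_sum_deg:
  assumes "finite X"
  shows "vol X \<le> 2 * (\<Sum>v\<in>X. deg v)"
proof -
  have "(\<Sum>v\<in>X. length (L Out v)) \<le> (\<Sum>v\<in>X. deg v)"
    by (intro sum_mono) (simp add: deg_def)
  moreover have "(\<Sum>v\<in>X. length (L In v)) \<le> (\<Sum>v\<in>X. deg v)" if both
    unfolding deg_def using that by (intro sum_mono) simp
  moreover have "sym_volume G X \<le> card (arcs_between G X V) + card (arcs_between G V X)"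
    by (simp add: sym_volume_def card_Un_le)
  ultimately show ?thesis
    using sum_length_L[OF assms] by (auto simp: vol_def volume_def)
qed

lemma sum_deg_le_vol:
  assumes "finite X"
  shows "(\<Sum>v\<in>X. deg v) \<le> 2 * vol X" "(\<Sum>v\<in>X. length (L Out v)) \<le> vol X"
proof -
  have 1: "(\<Sum>v\<in>X. length (L Out v)) \<le> vol X"
    using sum_length_L[OF assms] by (auto simp: vol_def volume_def sym_volume_def intro!: card_mono)
  have 2: "(\<Sum>v\<in>X. length (L In v)) \<le> vol X" if both
    unfolding vol_def sum_length_L[OF assms] using that by (auto simp: sym_volume_def intro!: card_mono)
  have "(\<Sum>v\<in>X. deg v) \<le> (\<Sum>v\<in>X. length (L Out v) + (if both then length (L In v) else 0))"
    by (intro sum_mono) (simp add: deg_def)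
  also have "\<dots> \<le> 2 * vol X"
    using 1 2 by (cases "both = True") (simp_all only: sum.distrib if_True if_False, simp_all)
  finally show "(\<Sum>v\<in>X. deg v) \<le> 2 * vol X" .
  show "(\<Sum>v\<in>X. length (L Out v)) \<le> vol X" by (rule 1)
qed

lemma vol_mono: "X \<subseteq> Y \<Longrightarrow> vol X \<le> vol Y"
  by (auto simp: vol_def volume_def sym_volume_def arcs_between_def intro!: card_mono)

section \<open>Small components that the search can afford to scan\<close>

definition target :: "nat \<Rightarrow> nat \<Rightarrow> nat set \<Rightarrow> bool" where
  "target k \<Delta> C \<longleftrightarrow> s \<in> C \<and> C \<subseteq> V \<and> card (cl C) \<le> card C + k \<and> (\<Sum>v\<in>C. deg v + 2) \<le> 6 * \<Delta>"

text \<open>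
  A component may contain many vertices without outgoing edges, which cost queries although they
  do not contribute to the volume. The part that is reachable from \<open>s\<close> inside the component is
  a component with at most \<open>\<Delta> + 1\<close> vertices.
\<close>

lemma ex_target:
  assumes C: "vertex_out_component G k C" "s \<in> C" "vol C \<le> \<Delta>" and "1 \<le> \<Delta>"
  shows "\<exists>C. target k \<Delta> C"
proof -
  define D where "D = {v. (s, v) \<in> (E \<inter> C \<times> C)\<^sup>*}"
  have sD: "s \<in> D" by (simp add: D_def)
  have DC: "D \<subseteq> C"
  proof
    fix v assume "v \<in> D"
    then have "(s, v) \<in> (E \<inter> C \<times> C)\<^sup>*" by (simp add: D_def)
    then show "v \<in> C" by cases (use C in auto)
  qed
  have CV: "C \<subseteq> V" using C by (simp add: vertex_out_component_def)
  have finD: "finite D" using DC CV finite_subset_V by blast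
  have DV: "D \<subseteq> V" using DC CV by blast
  have step: "w \<in> D" if "u \<in> D" "(u, w) \<in> E" "w \<in> C" for u w
    using that DC by (auto simp: D_def intro: rtrancl_into_rtrancl)
  \<comment> \<open>An edge from \<open>D\<close> into \<open>C\<close> ends in \<open>D\<close>, so
    every out-neighbour outside \<open>D\<close> is also one of \<open>C\<close> outside
    \<open>C\<close>.\<close>
  have "card {v \<in> V - D. \<exists>u\<in>D. (u, v) \<in> E} \<le> card {v \<in> V - C. \<exists>u\<in>C. (u, v) \<in> E}"
    using step DC by (intro card_mono) auto
  then have "card (cl D) \<le> card D + k"
    using C(1) card_cl[OF DV] by (simp add: vertex_out_component_def)
  have volD: "vol D \<le> \<Delta>" using vol_mono[OF DC] C(3) by simp
  \<comment> \<open>Except possibly for \<open>s\<close>, every vertex of \<open>D\<close> is the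
    head of an edge starting in \<open>D\<close>; this bounds vertices by edges plus one.\<close>
  have "D \<subseteq> insert s (snd ` arcs_between G D V)"
  proof
    fix v assume "v \<in> D"
    then have "(s, v) \<in> (E \<inter> C \<times> C)\<^sup>*" by (simp add: D_def)
    then show "v \<in> insert s (snd ` arcs_between G D V)"
      by cases (force simp: D_def arcs_between_def dest: arcD)+
  qed
  then have "card D \<le> card (insert s (snd ` arcs_between G D V))"
    by (intro card_mono) auto
  also have "\<dots> \<le> Suc (card (arcs_between G D V))"
    by (simp add: card_insert_if card_image_le le_SucI)
  also have "\<dots> \<le> \<Delta> + 1"
    using sum_deg_le_vol(2)[OF finD] volD by (simp add: sum_length_L finD)
  finally have "card D \<le> \<Delta> + 1" .
  \<comment> \<open>\<open>2 * \<Delta>\<close> for the degrees and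
    \<open>2 * (\<Delta> + 1)\<close> for the vertices; \<open>1 \<le> \<Delta>\<close> absorbs the
    remaining 2.\<close>
  then have "(\<Sum>v\<in>D. deg v + 2) \<le> 6 * \<Delta>"
    using sum_deg_le_vol(1)[OF finD] volD \<open>1 \<le> \<Delta>\<close> by (simp add: sum.distrib del: add_2_eq_Suc')
  with \<open>card (cl D) \<le> card D + k\<close> sD DV show ?thesis
    unfolding target_def by blast
qed

section \<open>Path maps and their load\<close>

definition valid :: "(nat \<Rightarrow> nat) \<Rightarrow> bool" where
  "valid g \<longleftrightarrow> (\<forall>w\<in>V. g w \<in> V \<and> w \<in> cl {g w})"

definition load :: "(nat \<Rightarrow> nat) \<Rightarrow> nat set \<Rightarrow> nat" where
  "load g X = card {w \<in> V. g w \<in> X}"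

lemma valid_id: "valid (\<lambda>w. w)"
  by (auto simp: valid_def cl_def)

lemma load_id: "load (\<lambda>w. w) X = card (V \<inter> X)"
  by (simp add: load_def Int_def)

text \<open>Redirecting one vertex moves one unit of load. The additive form avoids truncated
  subtraction.\<close>

lemma load_upd:
  assumes "w \<in> V"
  shows "load (g(w := y)) X + of_bool (g w \<in> X) = load g X + of_bool (y \<in> X)"
proof -
  let ?S = "{v \<in> V - {w}. g v \<in> X}"
  have "{v \<in> V. (g(w := y)) v \<in> X} = (if y \<in> X then insert w ?S else ?S)"
    "{v \<in> V. g v \<in> X} = (if g w \<in> X then insert w ?S else ?S)"
    using assms by auto
  then show ?thesis
    by (simp add: load_def)
qed

lemma cl_mono: "X \<subseteq> Y \<Longrightarrow> cl X \<subseteq> cl Y"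
  by (auto simp: cl_def)

lemma closed_component:
  assumes "X \<subseteq> V" "X \<noteq> {}" "\<And>w. w \<in> cl X \<Longrightarrow> g w \<in> X" "load g X \<le> card X + k"
  shows "vertex_out_component G k X"
proof -
  have "cl X \<subseteq> {w \<in> V. g w \<in> X}"
    using assms cl_subset by auto
  then have "card (cl X) \<le> load g X"
    unfolding load_def by (intro card_mono) auto
  then show ?thesis
    using assms by (simp add: vertex_out_component_iff)
qed

text \<open>Validity puts every \<open>w\<close> with \<open>g w\<close> in \<open>C\<close> into
  \<open>cl C\<close>, so the load counts a subset of \<open>cl C\<close>.\<close>

lemma target_load_le:
  assumes "valid g" "target k \<Delta> C"
  shows "load g C \<le> card C + k"
proof -
  have "{w \<in> V. g w \<in> C} \<subseteq> cl C"
    using assms cl_mono[of "{g _}" C] by (auto simp: valid_def)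
  then have "load g C \<le> card (cl C)"
    unfolding load_def using assms by (intro card_mono finite_subset_V cl_subset) (simp_all add: target_def)
  then show ?thesis
    using assms by (simp add: target_def)
qed

text \<open>Such a load forces the set counted by it to be all of \<open>cl C\<close>, so no
  residual edge leaves \<open>C\<close>.\<close>

lemma target_closed:
  assumes "valid g" "target k \<Delta> C" "card C + k \<le> load g C" "w \<in> cl C"
  shows "g w \<in> C"
proof -
  have "{w \<in> V. g w \<in> C} \<subseteq> cl C"
    using assms cl_mono[of "{g _}" C] by (auto simp: valid_def)
  moreover have "finite (cl C)"
    using assms by (intro finite_subset_V cl_subset) (simp add: target_def)
  moreover have "card (cl C) \<le> card {w \<in> V. g w \<in> C}"
    using assms by (simp add: target_def load_def)
  ultimately have "{w \<in> V. g w \<in> C} = cl C"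
    using card_seteq by blast
  then show ?thesis using assms by auto
qed

text \<open>
  Slot \<open>0\<close> of a vertex \<open>u\<close> stands for \<open>u\<close> itself, slot \<open>i \<ge> 1\<close> for the \<open>i\<close>-th
  queries at \<open>u\<close>. Slot \<open>deg u + 1\<close> is the one at which the end of the lists is noticed.
\<close>

definition cand :: "nat \<Rightarrow> nat \<Rightarrow> nat option" where
  "cand u i = (if i = 0 then Some u
    else if i \<le> length (L Out u) then Some (snd (L Out u ! (i - 1))) else None)"

lemma cand_cl:
  assumes "cand u i = Some w"
  shows "w \<in> cl {u}"
proof (cases "i = 0")
  case False
  then have "L Out u ! (i - 1) \<in> set (L Out u)" and "w = snd (L Out u ! (i - 1))"
    using assms by (auto simp: cand_def split: if_splits)
  then have "(u, w) \<in> E" by (metis (mono_tags, lifting) mem_Collect_eq prod.collapse set_L(1))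
  then show ?thesis by (simp add: cl_def)
qed (use assms in \<open>simp add: cand_def cl_def\<close>)

lemma cl_cand:
  assumes "w \<in> cl {u}"
  shows "\<exists>i<deg u + 2. cand u i = Some w"
proof (cases "w = u")
  case True
  then show ?thesis by (intro exI[of _ 0]) (simp add: cand_def)
next
  case False
  then have "(u, w) \<in> set (L Out u)"
    using assms by (auto simp: set_L cl_def)
  then obtain j where "j < length (L Out u)" "L Out u ! j = (u, w)"
    by (auto simp: in_set_conv_nth)
  then show ?thesis
    by (intro exI[of _ "Suc j"]) (auto simp: cand_def deg_def)
qed

text \<open>In the residual graph: no edge arising from the first \<open>m\<close> slots of
  \<open>u\<close> leaves \<open>X\<close>.\<close>

definition covered :: "(nat \<Rightarrow> nat) \<Rightarrow> nat set \<Rightarrow> nat \<Rightarrow> nat \<Rightarrow> bool" where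
  "covered g X u m \<longleftrightarrow> (\<forall>i<m. \<forall>w. cand u i = Some w \<longrightarrow> g w \<in> X)"

text \<open>
  The array \<open>U\<close> is a queue of \<open>n\<close> vertices, the first \<open>h\<close> of which are completely processed.
  The \<open>j\<close>-th slot that was processed belongs to the vertex at queue position \<open>T j\<close>.
  The vertex at position \<open>q\<close> was reached from the one at position \<open>P q\<close> via \<open>W q\<close>.
\<close>

definition search ::
  "(nat \<Rightarrow> nat) \<Rightarrow> (nat \<Rightarrow> nat) \<Rightarrow> (nat \<Rightarrow> nat) \<Rightarrow> (nat \<Rightarrow> nat) \<Rightarrow> (nat \<Rightarrow> nat) \<Rightarrow>
    nat \<Rightarrow> nat \<Rightarrow> nat \<Rightarrow> nat \<Rightarrow> bool" where
  "search g U W P T n h i j \<longleftrightarrow>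
     0 < n \<and> U 0 = s \<and> inj_on U {..<n} \<and> U ` {..<n} \<subseteq> V \<and> h \<le> n \<and> (h = n \<longrightarrow> i = 0) \<and>
     (\<forall>q. 0 < q \<and> q < n \<longrightarrow> P q < q \<and> W q \<in> cl {U (P q)} \<and> g (W q) = U q) \<and>
     (\<forall>q<h. covered g (U ` {..<n}) (U q) (deg (U q) + 2)) \<and>
     covered g (U ` {..<n}) (U h) i \<and> i \<le> deg (U h) + 1 \<and>
     (\<forall>t<j. T t < n) \<and>
     (\<forall>X. card {t. t < j \<and> U (T t) \<in> X} =
       (\<Sum>q<h. if U q \<in> X then deg (U q) + 2 else 0) + (if U h \<in> X then i else 0))"

lemma search_init: "U 0 = s \<Longrightarrow> search g U W P T 1 0 0 0"
  using start by (auto simp: search_def covered_def inj_on_def)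

text \<open>Discovering a vertex leaves the current slot open. It is closed by
  \<open>search_advance\<close>, for which the new vertex already counts as visited.\<close>

lemma search_extend:
  assumes S: "search g U W P T n h i j" and "h < n" "cand (U h) i = Some w" "g w \<notin> U ` {..<n}" "g w \<in> V"
  shows "search g (U(n := g w)) (W(n := w)) (P(n := h)) T (Suc n) h i j"
proof -
  let ?U = "U(n := g w)"
  have img: "?U ` {..<Suc n} = insert (g w) (U ` {..<n})"
    by (auto simp: lessThan_Suc)
  have "inj_on ?U {..<n}"
    using S inj_on_cong[of "{..<n}" ?U U] by (simp add: search_def)
  then have 1: "inj_on ?U {..<Suc n}"
    using assms(4) by (auto simp: lessThan_Suc)
  have 2: "{t. t < j \<and> ?U (T t) \<in> X} = {t. t < j \<and> U (T t) \<in> X}" for X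
    using S by (auto simp: search_def)
  have 3: "(\<Sum>q<h. if ?U q \<in> X then deg (?U q) + 2 else 0) = (\<Sum>q<h. if U q \<in> X then deg (U q) + 2 else 0)" for X
    using \<open>h < n\<close> by (intro sum.cong) auto
  have 4: "covered g (insert (g w) Y) u m" if "covered g Y u m" for Y u m
    using that by (auto simp: covered_def)
  have 5: "?U h = U h" using \<open>h < n\<close> by simp
  have 6: "(P(n := h)) q < q \<and> (W(n := w)) q \<in> cl {?U ((P(n := h)) q)} \<and> g ((W(n := w)) q) = ?U q"
    if "0 < q" "q < Suc n" for q
  proof (cases "q = n")
    case True
    then show ?thesis using \<open>h < n\<close> cand_cl[OF assms(3)] by auto
  next
    case False
    then have "q < n" using that by simp
    then have "P q < q \<and> W q \<in> cl {U (P q)} \<and> g (W q) = U q"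
      using S that unfolding search_def by blast
    then show ?thesis using \<open>q < n\<close> by simp
  qed
  show ?thesis
    unfolding search_def img 2 3 5
  proof (intro conjI)
    show "\<forall>q<h. covered g (insert (g w) (U ` {..<n})) (?U q) (deg (?U q) + 2)"
      using S \<open>h < n\<close> 4 by (simp add: search_def)
    show "\<forall>q. 0 < q \<and> q < Suc n \<longrightarrow> (P(n := h)) q < q \<and> (W(n := w)) q \<in> cl {?U ((P(n := h)) q)}
        \<and> g ((W(n := w)) q) = ?U q"
      using 6 by blast
  qed (use S assms 1 4 in \<open>auto simp: search_def less_SucI\<close>)
qed

text \<open>Slot \<open>deg (U h) + 1\<close> is the last one of the head, so the queue moves on
  after it. The counting clause grows exactly for the sets containing \<open>U h\<close>.\<close>

lemma search_advance:
  assumes S: "search g U W P T n h i j" and "h < n"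
    and cov: "\<And>w. cand (U h) i = Some w \<Longrightarrow> g w \<in> U ` {..<n}"
    and hi: "(h', i') = (if i = deg (U h) + 1 then (Suc h, 0) else (h, Suc i))"
  shows "search g U W P (T(j := h)) n h' i' (Suc j)"
proof -
  have 1: "card {t. t < Suc j \<and> U ((T(j := h)) t) \<in> X} =
      card {t. t < j \<and> U (T t) \<in> X} + (if U h \<in> X then 1 else 0)" for X
  proof -
    have "{t. t < Suc j \<and> U ((T(j := h)) t) \<in> X} =
      (if U h \<in> X then insert j {t. t < j \<and> U (T t) \<in> X} else {t. t < j \<and> U (T t) \<in> X})"
      by (auto simp: less_Suc_eq)
    then show ?thesis by simp
  qed
  have 2: "covered g (U ` {..<n}) (U h) (Suc i)"
    using S cov by (auto simp: search_def covered_def less_Suc_eq)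
  show ?thesis
  proof (cases "i = deg (U h) + 1")
    case True
    then have "h' = Suc h" "i' = 0" using hi by auto
    then show ?thesis
      unfolding search_def 1
      using S \<open>h < n\<close> 2 True by (auto simp: search_def less_Suc_eq covered_def[of _ _ _ 0])
  next
    case False
    then have "h' = h" "i' = Suc i" using hi by auto
    then show ?thesis
      unfolding search_def 1
      using S \<open>h < n\<close> 2 False by (auto simp: search_def less_Suc_eq)
  qed
qed

text \<open>In an exhausted queue all slots of all visited vertices are covered, and by
  \<open>cl_cand\<close> the slots of a vertex reach its whole closure.\<close>

lemma search_finished:
  assumes "search g U W P T n n i j" "w \<in> cl (U ` {..<n})"
  shows "g w \<in> U ` {..<n}"
proof -
  obtain q where "q < n" "w \<in> cl {U q}"
    using assms(2) by (auto simp: cl_def)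
  moreover obtain m where "m < deg (U q) + 2" "cand (U q) m = Some w"
    using cl_cand[OF \<open>w \<in> cl {U q}\<close>] by blast
  ultimately show ?thesis
    using assms(1) by (auto simp: search_def covered_def)
qed

lemma search_vol:
  assumes "search g U W P T n n i j"
  shows "vol (U ` {..<n}) \<le> 2 * j"
proof -
  have "(\<Sum>v\<in>U ` {..<n}. deg v) = (\<Sum>q<n. deg (U q))"
    using assms by (subst sum.reindex) (auto simp: search_def)
  also have "\<dots> \<le> (\<Sum>q<n. deg (U q) + 2)"
    by (intro sum_mono) simp
  \<comment> \<open>The counting clause for \<open>X = UNIV\<close>: all slots of the visited
    vertices are among the \<open>j\<close> processed ones.\<close>
  also have "\<dots> \<le> j"
    using assms[unfolded search_def] by (auto dest!: spec[of _ UNIV])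
  finally show ?thesis
    using vol_le_sum_deg[of "U ` {..<n}"] by simp
qed

text \<open>A vertex enters the queue at most once and offers \<open>deg v + 2\<close> slots;
  \<open>target\<close> bounds their total over \<open>C\<close>.\<close>

lemma search_target_slots:
  assumes S: "search g U W P T n h i j" and C: "target k \<Delta> C"
  shows "card {t. t < j \<and> U (T t) \<in> C} \<le> 6 * \<Delta>"
proof -
  have inj: "inj_on U {..<n}" and "h \<le> n" "h = n \<longrightarrow> i = 0" "i \<le> deg (U h) + 1"
    using S by (auto simp: search_def)
  let ?f = "\<lambda>v. if v \<in> C then deg v + 2 else 0"
  have finC: "finite C" using C finite_subset_V by (simp add: target_def)
  have "card {t. t < j \<and> U (T t) \<in> C} = (\<Sum>q<h. ?f (U q)) + (if U h \<in> C then i else 0)"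
    using S unfolding search_def by blast
  also have "\<dots> \<le> (\<Sum>q<n. ?f (U q))"
  proof (cases "h = n")
    case False
    \<comment> \<open>The partly processed head contributes \<open>i \<le> deg (U h) + 1\<close>
      slots, fewer than its full number.\<close>
    then have "(\<Sum>q<h. ?f (U q)) + ?f (U h) = (\<Sum>q<Suc h. ?f (U q))" by simp
    also have "\<dots> \<le> (\<Sum>q<n. ?f (U q))"
      using False \<open>h \<le> n\<close> by (intro sum_mono2) auto
    finally show ?thesis using \<open>i \<le> deg (U h) + 1\<close> by (auto split: if_splits)
  qed (use \<open>h = n \<longrightarrow> i = 0\<close> in auto)
  also have "\<dots> = (\<Sum>v\<in>U ` {..<n}. ?f v)"
    using inj by (simp add: sum.reindex)
  also have "\<dots> = (\<Sum>v\<in>U ` {..<n} \<inter> C. deg v + 2)"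
    by (simp add: sum.inter_restrict del: add_2_eq_Suc')
  also have "\<dots> \<le> (\<Sum>v\<in>C. deg v + 2)"
    using finC by (intro sum_mono2) auto
  also have "\<dots> \<le> 6 * \<Delta>"
    using C by (simp add: target_def)
  finally show ?thesis .
qed

text \<open>Induction along the predecessor positions: no residual edge leaves \<open>C\<close>, so
  a search from \<open>s\<close> stays inside.\<close>

lemma search_in_target:
  assumes S: "search g U W P T n h i j" and "s \<in> C" and closed: "\<And>w. w \<in> cl C \<Longrightarrow> g w \<in> C"
  shows "q < n \<Longrightarrow> U q \<in> C"
proof (induction q rule: less_induct)
  case (less q)
  show ?case
  proof (cases "q = 0")
    case True
    then show ?thesis using S \<open>s \<in> C\<close> by (simp add: search_def)
  next
    case False
    then have q: "P q < q" "W q \<in> cl {U (P q)}" "g (W q) = U q"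
      using S less.prems by (auto simp: search_def)
    then have "U (P q) \<in> C" using less by auto
    then have "W q \<in> cl C" using q(2) cl_mono[of "{U (P q)}" C] by auto
    then show ?thesis using closed q(3) by metis
  qed
qed

text \<open>At this load \<open>C\<close> is closed, so all processed slots belong to it.
  Contrapositively, a search seeing more than \<open>6 * \<Delta>\<close> slots shows that the load
  of \<open>C\<close> is still smaller.\<close>

lemma search_finishes_in_target:
  assumes S: "search g U W P T n h i j" and "target k \<Delta> C" and "valid g" "card C + k \<le> load g C"
  shows "j \<le> 6 * \<Delta>"
proof -
  have "U (T t) \<in> C" if "t < j" for t
    using search_in_target[OF S _ target_closed[OF assms(3,2,4)]] assms(2) S that
    by (auto simp: target_def search_def)
  then have "{t. t < j \<and> U (T t) \<in> C} = {..<j}" by auto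
  then show ?thesis
    using search_target_slots[OF S assms(2)] by simp
qed

text \<open>
  The state of an augmentation from queue position \<open>t\<close>, with the entries of \<open>g\<close> above
  position \<open>x\<close> already redirected, so that \<open>U x\<close> temporarily lacks one unit of load.
\<close>

definition augmenting ::
  "(nat \<Rightarrow> nat) \<Rightarrow> (nat \<Rightarrow> nat) \<Rightarrow> (nat \<Rightarrow> nat) \<Rightarrow> (nat \<Rightarrow> nat) \<Rightarrow> nat \<Rightarrow> nat \<Rightarrow>
    (nat \<Rightarrow> nat) \<Rightarrow> nat \<Rightarrow> bool" where
  "augmenting g0 U W P n t g x \<longleftrightarrow> x < n \<and> valid g \<and>
     (\<forall>q. 0 < q \<and> q \<le> x \<longrightarrow> g (W q) = U q) \<and>
     (\<forall>X. load g X + of_bool (U t \<in> X) = load g0 X + of_bool (U x \<in> X))"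

lemma augmenting_init:
  assumes "search g U W P T n h i j" "valid g" "t < n"
  shows "augmenting g U W P n t g t"
  using assms by (auto simp: augmenting_def search_def)

text \<open>Redirecting \<open>W x\<close> from \<open>U x\<close> to \<open>U (P x)\<close> passes
  the surplus unit over \<open>g0\<close> one position back along the search path.\<close>

lemma augmenting_step:
  assumes S: "search g0 U W P T n h i j" and A: "augmenting g0 U W P n t g x" and "0 < x"
  shows "augmenting g0 U W P n t (g(W x := U (P x))) (P x)" and "P x < x"
proof -
  have "x < n" using A by (simp add: augmenting_def)
  with S \<open>0 < x\<close> have x: "P x < x" "W x \<in> cl {U (P x)}" "x < n" "inj_on U {..<n}" "U ` {..<n} \<subseteq> V"
    unfolding search_def by blast+
  then have PV: "U (P x) \<in> V" by force
  have g: "valid g" "\<And>q. 0 < q \<Longrightarrow> q \<le> x \<Longrightarrow> g (W q) = U q"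
    using A by (auto simp: augmenting_def)
  have WV: "W x \<in> V" using x(2) PV cl_subset[of "{U (P x)}"] by auto
  \<comment> \<open>As \<open>g (W q) = U q\<close> and \<open>U\<close> is injective,
    \<open>W q = W x\<close> would force \<open>q = x\<close>. Hence the redirection leaves the
    remaining path intact.\<close>
  have ne: "W q \<noteq> W x" if "0 < q" "q \<le> P x" for q
  proof
    assume "W q = W x"
    then have "U q = U x" using g(2)[of q] g(2)[of x] that x \<open>0 < x\<close> by auto
    then show False using inj_onD[OF x(4)] that x by force
  qed
  have "load (g(W x := U (P x))) X + of_bool (U t \<in> X) = load g0 X + of_bool (U (P x) \<in> X)" for X
  proof -
    have "load g X + of_bool (U t \<in> X) = load g0 X + of_bool (U x \<in> X)"
      using A unfolding augmenting_def by blast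
    then show ?thesis
      using load_upd[OF WV, of g "U (P x)" X] g(2)[of x] \<open>0 < x\<close> by simp
  qed
  moreover have "valid (g(W x := U (P x)))"
    using g(1) x PV by (auto simp: valid_def)
  ultimately show "augmenting g0 U W P n t (g(W x := U (P x))) (P x)"
    using x g(2) ne by (auto simp: augmenting_def)
  show "P x < x" by (rule x)
qed

lemma augmenting_final:
  assumes "augmenting g0 U W P n t g 0" "U 0 = s"
  shows "valid g" "load g X \<le> load g0 X + 1" "s \<in> X \<Longrightarrow> U t \<notin> X \<Longrightarrow> load g X = load g0 X + 1"
proof -
  have "load g X + of_bool (U t \<in> X) = load g0 X + of_bool (s \<in> X)"
    using assms by (auto simp: augmenting_def)
  then show "load g X \<le> load g0 X + 1" "s \<in> X \<Longrightarrow> U t \<notin> X \<Longrightarrow> load g X = load g0 X + 1"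
    by (auto split: if_splits simp: of_bool_def)
  show "valid g" using assms by (simp add: augmenting_def)
qed

end

section \<open>The program\<close>

abbreviation "S x \<equiv> Elem x (N 0)"

text \<open>\<open>b\<close> tells whether the slot has a candidate, left in \<open>w\<close>, and
  \<open>c\<close> whether the incoming query succeeded. So \<open>b = c = 0\<close> marks the end
  of the lists; slot 0 makes no query.\<close>

definition probe :: "bool \<Rightarrow> com" where
  "probe both =
    Seq (Assign ''u'' (N 0) (Elem ''U'' (S ''h'')))
   (Seq (Assign ''T'' (S ''j'') (S ''h''))
   (Seq (Assign ''j'' (N 0) (Plus (S ''j'') (N 1)))
     (If (Less (S ''i'') (N 1))
       (Seq (Assign ''w'' (N 0) (S ''u'')) (Seq (Assign ''b'' (N 0) (N 1)) (Assign ''c'' (N 0) (N 0))))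
       (Seq (Query Out (S ''u'') (S ''i'') ''b'' ''y'' ''w'')
         (if both then Query In (S ''u'') (S ''i'') ''c'' ''y'' ''z'' else Assign ''c'' (N 0) (N 0))))))"

text \<open>
  The current map \<open>g\<close> is stored in \<open>G\<close>, but only at those indices whose time stamp in \<open>H\<close> is
  the number \<open>e\<close> of the current repetition; elsewhere \<open>g\<close> is the identity. Likewise, \<open>A\<close>
  holds time stamps of visited vertices.
\<close>

definition gfun :: "state \<Rightarrow> nat \<Rightarrow> nat" where
  "gfun \<sigma> w = (if mem \<sigma> ''H'' w < mem \<sigma> ''e'' 0 then w else mem \<sigma> ''G'' w)"

definition visit :: com where
  "visit = If (Less (N 0) (S ''b''))
     (Seq (If (Less (Elem ''H'' (S ''w'')) (S ''e''))
            (Assign ''x'' (N 0) (S ''w'')) (Assign ''x'' (N 0) (Elem ''G'' (S ''w''))))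
       (If (Less (Elem ''A'' (S ''x'')) (S ''a''))
         (Seq (Assign ''A'' (S ''x'') (S ''a''))
         (Seq (Assign ''U'' (S ''n'') (S ''x''))
         (Seq (Assign ''W'' (S ''n'') (S ''w''))
         (Seq (Assign ''P'' (S ''n'') (S ''h''))
           (Assign ''n'' (N 0) (Plus (S ''n'') (N 1)))))))
         Skip))
     Skip"

definition advance :: com where
  "advance = If (Less (N 0) (Plus (S ''b'') (S ''c'')))
     (Assign ''i'' (N 0) (Plus (S ''i'') (N 1)))
     (Seq (Assign ''h'' (N 0) (Plus (S ''h'') (N 1))) (Assign ''i'' (N 0) (N 0)))"

definition search_loop :: "bool \<Rightarrow> com" where
  "search_loop both = While (Conj (Less (S ''j'') (S ''M'')) (Less (S ''h'') (S ''n'')))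
     (Seq (probe both) (Seq visit advance))"

text \<open>Raising \<open>a\<close> clears the visited set in one step, because all old stamps
  become smaller.\<close>

definition start_search :: com where
  "start_search =
    Seq (Assign ''a'' (N 0) (Plus (S ''a'') (N 1)))
   (Seq (Assign ''U'' (N 0) (S ''s''))
   (Seq (Assign ''A'' (S ''s'') (S ''a''))
   (Seq (Assign ''n'' (N 0) (N 1))
   (Seq (Assign ''h'' (N 0) (N 0))
   (Seq (Assign ''i'' (N 0) (N 0)) (Assign ''j'' (N 0) (N 0)))))))"

text \<open>On entry \<open>x\<close> is a slot number, which \<open>T\<close> turns into a queue
  position; the loop follows \<open>P\<close> down to the root 0.\<close>

definition augment :: com where
  "augment = Seq (Assign ''x'' (N 0) (Elem ''T'' (S ''x'')))
     (While (Less (N 0) (S ''x''))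
       (Seq (Assign ''H'' (Elem ''W'' (S ''x'')) (S ''e''))
       (Seq (Assign ''G'' (Elem ''W'' (S ''x'')) (Elem ''U'' (Elem ''P'' (S ''x''))))
         (Assign ''x'' (N 0) (Elem ''P'' (S ''x''))))))"

text \<open>A uniform slot selects a vertex with probability proportional to its processed slots.
  Setting \<open>n\<close> to 0 makes an unsuccessful run return the empty set.\<close>

definition conclude :: com where
  "conclude = If (Less (S ''h'') (S ''n''))
     (Seq (Assign ''n'' (N 0) (N 0)) (Seq (Rand ''x'' (Minus (S ''M'') (N 1))) augment))
     (Assign ''f'' (N 0) (N 1))"

definition search_round :: "bool \<Rightarrow> com" where
  "search_round both = Seq (Seq start_search (search_loop both))
     (Seq conclude (Assign ''r'' (N 0) (Plus (S ''r'') (N 1))))"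

definition rounds :: "bool \<Rightarrow> com" where
  "rounds both = While (Conj (Less (S ''r'') (Plus (S ''k'') (N 1))) (Less (S ''f'') (N 1))) (search_round both)"

text \<open>After \<open>e\<close> repetitions, \<open>y\<close> is \<open>2 ^ e * (1 - p)\<close>, so \<open>y \<ge> 1\<close> means \<open>(1 / 2) ^ e \<le> 1 - p\<close>.\<close>

definition repetitions :: "bool \<Rightarrow> com" where
  "repetitions both = While (Conj (RLess (R ''y'') ROne) (Less (S ''f'') (N 1)))
     (Seq (Assign ''e'' (N 0) (Plus (S ''e'') (N 1)))
     (Seq (Assign ''r'' (N 0) (N 0))
     (Seq (RAssign ''y'' (RPlus (R ''y'') (R ''y''))) (rounds both))))"

text \<open>Computes \<open>M = 6 * \<Delta> + 1 + 12 * \<Delta> * k\<close> by additions alone, as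
  multiplication is not primitive. A target has at most \<open>6 * \<Delta>\<close> slots, which is
  less than the fraction \<open>1 / (2 * k + 1)\<close> of \<open>M\<close>.\<close>

definition budget :: com where
  "budget =
    Seq (Assign ''d'' (N 0) (Plus (S ''Delta'') (S ''Delta'')))
   (Seq (Assign ''d'' (N 0) (Plus (S ''d'') (Plus (S ''d'') (S ''d''))))
   (Seq (Assign ''M'' (N 0) (Plus (S ''d'') (N 1)))
     (While (Less (S ''i'') (S ''k''))
       (Seq (Assign ''M'' (N 0) (Plus (S ''M'') (Plus (S ''d'') (S ''d''))))
         (Assign ''i'' (N 0) (Plus (S ''i'') (N 1)))))))"

definition program :: "bool \<Rightarrow> com" where
  "program both = Seq budget (Seq (RAssign ''y'' (RMinus ROne (R ''p''))) (repetitions both))"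

section \<open>Effects and costs of the program fragments\<close>

context listed_graph
begin

text \<open>A frame condition combined with cost bounds. Legality of the queries is carried along
  because the query times are bounded only for legal histories.\<close>

definition eff :: "vname set \<Rightarrow> nat \<Rightarrow> nat \<Rightarrow> state \<Rightarrow> state \<Rightarrow> bool" where
  "eff X q t \<sigma> \<sigma>' \<longleftrightarrow> (\<forall>x. x \<notin> X \<longrightarrow> mem \<sigma>' x = mem \<sigma> x) \<and> rmem \<sigma>' = rmem \<sigma> \<and>
     steps \<sigma>' \<le> steps \<sigma> + t \<and>
     (\<exists>qs. queries \<sigma>' = queries \<sigma> @ qs \<and> length qs \<le> q \<and> set qs \<subseteq> legal_queries G)"

lemma eff_refl: "eff X q t \<sigma> \<sigma>"
  by (simp add: eff_def)

lemma eff_trans: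
  assumes "eff X q t \<sigma> \<sigma>'" "eff Y q' t' \<sigma>' \<sigma>''" "X \<union> Y \<subseteq> Z" "q + q' \<le> q''" "t + t' \<le> t''"
  shows "eff Z q'' t'' \<sigma> \<sigma>''"
proof -
  obtain qs qs' where "queries \<sigma>' = queries \<sigma> @ qs" "length qs \<le> q" "set qs \<subseteq> legal_queries G"
    "queries \<sigma>'' = queries \<sigma>' @ qs'" "length qs' \<le> q'" "set qs' \<subseteq> legal_queries G"
    using assms(1,2) by (auto simp: eff_def)
  then have "\<exists>qs. queries \<sigma>'' = queries \<sigma> @ qs \<and> length qs \<le> q'' \<and> set qs \<subseteq> legal_queries G"
    using assms(4) by (intro exI[of _ "qs @ qs'"]) auto
  moreover have "mem \<sigma>'' x = mem \<sigma> x" if "x \<notin> Z" for x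
    using assms(1-3) that by (metis UnCI eff_def subsetD)
  ultimately show ?thesis
    using assms(1,2,5) by (simp add: eff_def)
qed

lemma eff_mem: "eff X q t \<sigma> \<sigma>' \<Longrightarrow> x \<notin> X \<Longrightarrow> mem \<sigma>' x = mem \<sigma> x"
  by (simp add: eff_def)

lemma eff_local:
  assumes "\<And>x. x \<notin> X \<Longrightarrow> mem \<sigma>' x = mem \<sigma> x" "rmem \<sigma>' = rmem \<sigma>" "steps \<sigma>' \<le> steps \<sigma> + t" "queries \<sigma>' = queries \<sigma>"
  shows "eff X q t \<sigma> \<sigma>'"
  using assms by (simp add: eff_def)

lemma ok_probe:
  assumes "mem \<sigma> ''U'' (mem \<sigma> ''h'' 0) = u" "mem \<sigma> ''i'' 0 = i" "u \<in> V" "i \<le> deg u + 1"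
  shows "ok L (probe both) \<sigma> (\<lambda>\<sigma>'.
    eff {''u'',''T'',''j'',''w'',''b'',''c'',''y'',''z''} 2 10 \<sigma> \<sigma>' \<and>
    mem \<sigma>' ''T'' = (mem \<sigma> ''T'')(mem \<sigma> ''j'' 0 := mem \<sigma> ''h'' 0) \<and>
    mem \<sigma>' ''j'' 0 = Suc (mem \<sigma> ''j'' 0) \<and>
    (0 < mem \<sigma>' ''b'' 0 \<longleftrightarrow> cand u i \<noteq> None) \<and>
    (\<forall>w. cand u i = Some w \<longrightarrow> mem \<sigma>' ''w'' 0 = w) \<and>
    (0 < mem \<sigma>' ''b'' 0 + mem \<sigma>' ''c'' 0 \<longleftrightarrow> i \<noteq> deg u + 1))"
proof -
  \<comment> \<open>The two lists may run out at different indices; only at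
    \<open>i = deg u + 1\<close> do all queries of the slot fail.\<close>
  consider "i = 0" | "i \<ge> 1" "i \<le> length (L Out u)" "i \<le> length (L In u)"
    | "i \<ge> 1" "i \<le> length (L Out u)" "length (L In u) < i"
    | "i \<ge> 1" "length (L Out u) < i" "i \<le> length (L In u)"
    | "i \<ge> 1" "length (L Out u) < i" "length (L In u) < i"
    by linarith
  then show ?thesis
    using assms unfolding probe_def deg_def
    by cases (auto simp: eff_def ask_hit ask_miss cand_def legal_queries_def)
qed

lemma ok_visit:
  assumes "\<And>x. mem \<sigma> ''A'' x \<le> mem \<sigma> ''a'' 0"
  shows "ok L visit \<sigma> (\<lambda>\<sigma>'.
    let w = mem \<sigma> ''w'' 0; x = gfun \<sigma> w; n = mem \<sigma> ''n'' 0 in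
    eff {''x'',''A'',''U'',''W'',''P'',''n''} 0 9 \<sigma> \<sigma>' \<and>
    (if 0 < mem \<sigma> ''b'' 0 \<and> mem \<sigma> ''A'' x \<noteq> mem \<sigma> ''a'' 0
     then mem \<sigma>' ''A'' = (mem \<sigma> ''A'')(x := mem \<sigma> ''a'' 0) \<and> mem \<sigma>' ''U'' = (mem \<sigma> ''U'')(n := x) \<and>
       mem \<sigma>' ''W'' = (mem \<sigma> ''W'')(n := w) \<and> mem \<sigma>' ''P'' = (mem \<sigma> ''P'')(n := mem \<sigma> ''h'' 0) \<and>
       mem \<sigma>' ''n'' 0 = Suc n
     else mem \<sigma>' ''A'' = mem \<sigma> ''A'' \<and> mem \<sigma>' ''U'' = mem \<sigma> ''U'' \<and>
       mem \<sigma>' ''W'' = mem \<sigma> ''W'' \<and> mem \<sigma>' ''P'' = mem \<sigma> ''P'' \<and> mem \<sigma>' ''n'' 0 = n))"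
proof -
  \<comment> \<open>Stamps never exceed \<open>a\<close>, so the test with \<open><\<close> means:
    not yet visited in this search.\<close>
  have "mem \<sigma> ''A'' x < mem \<sigma> ''a'' 0 \<longleftrightarrow> mem \<sigma> ''A'' x \<noteq> mem \<sigma> ''a'' 0" for x
    using assms[of x] by auto
  then show ?thesis
    unfolding visit_def Let_def gfun_def by (auto simp: eff_def)
qed

lemma ok_advance:
  "ok L advance \<sigma> (\<lambda>\<sigma>'. eff {''i'',''h''} 0 3 \<sigma> \<sigma>' \<and>
    (mem \<sigma>' ''h'' 0, mem \<sigma>' ''i'' 0) = (if 0 < mem \<sigma> ''b'' 0 + mem \<sigma> ''c'' 0
      then (mem \<sigma> ''h'' 0, Suc (mem \<sigma> ''i'' 0)) else (Suc (mem \<sigma> ''h'' 0), 0)))"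
  unfolding advance_def by (auto simp: eff_def)

text \<open>Every slot discovers at most one vertex, whence \<open>n \<le> j + 1\<close>; this
  bounds the length of an augmenting path by the budget.\<close>

definition searching :: "state \<Rightarrow> bool" where
  "searching \<sigma> \<longleftrightarrow>
     search (gfun \<sigma>) (mem \<sigma> ''U'') (mem \<sigma> ''W'') (mem \<sigma> ''P'') (mem \<sigma> ''T'')
       (mem \<sigma> ''n'' 0) (mem \<sigma> ''h'' 0) (mem \<sigma> ''i'' 0) (mem \<sigma> ''j'' 0) \<and>
     (\<forall>x. mem \<sigma> ''A'' x \<le> mem \<sigma> ''a'' 0 \<and>
       (mem \<sigma> ''A'' x = mem \<sigma> ''a'' 0 \<longleftrightarrow> x \<in> mem \<sigma> ''U'' ` {..<mem \<sigma> ''n'' 0})) \<and>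
     mem \<sigma> ''n'' 0 \<le> mem \<sigma> ''j'' 0 + 1 \<and> mem \<sigma> ''j'' 0 \<le> mem \<sigma> ''M'' 0"

definition search_vars :: "vname set" where
  "search_vars = {''u'',''T'',''j'',''w'',''b'',''c'',''y'',''z'',''x'',''A'',''U'',''W'',''P'',''n'',''i'',''h''}"

lemma search_head:
  "search g U W P T n h i j \<Longrightarrow> h < n \<Longrightarrow> U h \<in> V \<and> i \<le> deg (U h) + 1"
  by (auto simp: search_def)

lemma gfun_cong:
  "mem \<sigma>' ''H'' = mem \<sigma> ''H'' \<Longrightarrow> mem \<sigma>' ''G'' = mem \<sigma> ''G'' \<Longrightarrow> mem \<sigma>' ''e'' = mem \<sigma> ''e'' \<Longrightarrow> gfun \<sigma>' = gfun \<sigma>"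
  by (simp add: gfun_def fun_eq_iff)

lemma gfun_tick [simp]: "gfun (tick \<sigma>) = gfun \<sigma>"
  by (rule gfun_cong) simp_all

lemma valid_cand:
  assumes "valid g" "u \<in> V" "cand u i = Some w"
  shows "g w \<in> V"
  using assms cand_cl[OF assms(3)] cl_subset[of "{u}"] by (auto simp: valid_def)

lemma ok_search_step:
  assumes I: "searching \<sigma>" and "valid (gfun \<sigma>)"
    and b: "mem \<sigma> ''j'' 0 < mem \<sigma> ''M'' 0" "mem \<sigma> ''h'' 0 < mem \<sigma> ''n'' 0"
  shows "ok L (Seq (probe both) (Seq visit advance)) \<sigma> (\<lambda>\<sigma>'.
    searching \<sigma>' \<and> eff search_vars 2 22 \<sigma> \<sigma>' \<and> mem \<sigma>' ''j'' 0 = Suc (mem \<sigma> ''j'' 0))"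
proof -
  let ?h = "mem \<sigma> ''h'' 0" and ?i = "mem \<sigma> ''i'' 0" and ?j = "mem \<sigma> ''j'' 0" and ?n = "mem \<sigma> ''n'' 0"
  let ?u = "mem \<sigma> ''U'' ?h" and ?g = "gfun \<sigma>"
  let ?vis = "mem \<sigma> ''U'' ` {..<?n}"
  have S: "search ?g (mem \<sigma> ''U'') (mem \<sigma> ''W'') (mem \<sigma> ''P'') (mem \<sigma> ''T'') ?n ?h ?i ?j"
    and A: "\<And>x. mem \<sigma> ''A'' x \<le> mem \<sigma> ''a'' 0" "\<And>x. mem \<sigma> ''A'' x = mem \<sigma> ''a'' 0 \<longleftrightarrow> x \<in> ?vis"
    using I by (auto simp: searching_def)
  have u: "?u \<in> V" "?i \<le> deg ?u + 1"
    using search_head[OF S b(2)] by auto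
  show ?thesis
    unfolding ok_simps
  proof (rule ok_mono[OF ok_probe[OF refl refl u]], elim conjE, goal_cases)
    case (1 \<sigma>1)
    note e1 = 1(1) and p = 1(2-)
    note m1 = eff_mem[OF e1]
    have g1: "gfun \<sigma>1 = ?g" by (rule gfun_cong) (simp_all add: m1)
    have "\<And>x. mem \<sigma>1 ''A'' x \<le> mem \<sigma>1 ''a'' 0" using A by (simp add: m1)
    from ok_visit[OF this] show ?case
      unfolding Let_def g1
    proof (rule ok_mono, goal_cases)
      case (1 \<sigma>2)
      note e2 = conjunct1[OF 1]
      note m2 = eff_mem[OF e2]
      \<comment> \<open>\<open>new\<close> decides whether the visit is a
        \<open>search_extend\<close>; in either case \<open>search_advance\<close> then closes the
        slot.\<close>
      define new where "new \<longleftrightarrow> cand ?u ?i \<noteq> None \<and> ?g (mem \<sigma>1 ''w'' 0) \<notin> ?vis"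
      have v: "if new then mem \<sigma>2 ''A'' = (mem \<sigma> ''A'')(?g (mem \<sigma>1 ''w'' 0) := mem \<sigma> ''a'' 0) \<and>
          mem \<sigma>2 ''U'' = (mem \<sigma> ''U'')(?n := ?g (mem \<sigma>1 ''w'' 0)) \<and>
          mem \<sigma>2 ''W'' = (mem \<sigma> ''W'')(?n := mem \<sigma>1 ''w'' 0) \<and>
          mem \<sigma>2 ''P'' = (mem \<sigma> ''P'')(?n := ?h) \<and> mem \<sigma>2 ''n'' 0 = Suc ?n
        else mem \<sigma>2 ''A'' = mem \<sigma> ''A'' \<and> mem \<sigma>2 ''U'' = mem \<sigma> ''U'' \<and>
          mem \<sigma>2 ''W'' = mem \<sigma> ''W'' \<and> mem \<sigma>2 ''P'' = mem \<sigma> ''P'' \<and> mem \<sigma>2 ''n'' 0 = ?n"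
        using conjunct2[OF 1] p(3) unfolding new_def by (simp add: m1 A(2))
      have cand: "mem \<sigma>1 ''w'' 0 = w" if "cand ?u ?i = Some w" for w
        using p(4) that by blast
      have U2: "mem \<sigma>2 ''U'' ?h = ?u" using v b(2) by (auto split: if_splits)
      have img: "mem \<sigma>2 ''U'' ` {..<mem \<sigma>2 ''n'' 0} = (if new then insert (?g (mem \<sigma>1 ''w'' 0)) ?vis else ?vis)"
        using v by (auto simp: lessThan_Suc split: if_splits)
      have S2: "search ?g (mem \<sigma>2 ''U'') (mem \<sigma>2 ''W'') (mem \<sigma>2 ''P'') (mem \<sigma> ''T'') (mem \<sigma>2 ''n'' 0) ?h ?i ?j"
      proof (cases new)
        case True
        then obtain w where w: "cand ?u ?i = Some w" "?g w \<notin> ?vis"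
          using cand unfolding new_def by auto
        show ?thesis
          using search_extend[OF S b(2) w valid_cand[OF assms(2) u(1) w(1)]] v True cand[OF w(1)] by simp
      qed (use S v in simp)
      have cov: "?g w \<in> mem \<sigma>2 ''U'' ` {..<mem \<sigma>2 ''n'' 0}" if "cand (mem \<sigma>2 ''U'' ?h) ?i = Some w" for w
        using cand[of w] that unfolding img U2 new_def by auto
      have hn: "?h < mem \<sigma>2 ''n'' 0" using v b(2) by (auto split: if_splits)
      show ?case
      proof (rule ok_mono[OF ok_advance], elim conjE, goal_cases)
        case (1 \<sigma>3)
        note e3 = 1(1)
        note m3 = eff_mem[OF e3]
        have g3: "gfun \<sigma>3 = ?g"
          by (rule gfun_cong) (simp_all add: m1 m2 m3)
        have hi: "(mem \<sigma>3 ''h'' 0, mem \<sigma>3 ''i'' 0) =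
            (if ?i = deg (mem \<sigma>2 ''U'' ?h) + 1 then (Suc ?h, 0) else (?h, Suc ?i))"
          using 1(2) p(5) unfolding U2 by (simp add: m1 m2)
        have S3: "search ?g (mem \<sigma>3 ''U'') (mem \<sigma>3 ''W'') (mem \<sigma>3 ''P'') (mem \<sigma>3 ''T'')
            (mem \<sigma>3 ''n'' 0) (mem \<sigma>3 ''h'' 0) (mem \<sigma>3 ''i'' 0) (mem \<sigma>3 ''j'' 0)"
          using search_advance[OF S2 hn cov hi] p(1,2) by (simp add: m1 m2 m3)
        have n2: "mem \<sigma>2 ''n'' 0 \<le> Suc ?n" using v by (auto split: if_splits)
        have A3: "mem \<sigma>3 ''A'' x \<le> mem \<sigma>3 ''a'' 0 \<and>
            (mem \<sigma>3 ''A'' x = mem \<sigma>3 ''a'' 0 \<longleftrightarrow> x \<in> mem \<sigma>3 ''U'' ` {..<mem \<sigma>3 ''n'' 0})" for x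
          using v A(1)[of x] A(2)[of x] img by (auto simp: m1 m2 m3 split: if_splits)
        have "searching \<sigma>3"
          unfolding searching_def g3
          using S3 A3 n2 I b p(2) by (auto simp: m1 m2 m3 searching_def)
        moreover have "eff search_vars 2 22 \<sigma> \<sigma>3"
          by (rule eff_trans[OF eff_trans[OF e1 e2 order.refl order.refl order.refl] e3])
             (simp_all add: search_vars_def)
        ultimately show ?case
          using p(2) by (simp add: m2 m3)
      qed
    qed
  qed
qed

lemma ok_search_loop:
  assumes "searching \<sigma>0" "valid (gfun \<sigma>0)" "mem \<sigma>0 ''j'' 0 = 0"
  shows "ok L (search_loop both) \<sigma>0 (\<lambda>\<sigma>.
    searching \<sigma> \<and> eff search_vars (2 * mem \<sigma>0 ''M'' 0) (23 * mem \<sigma>0 ''M'' 0 + 1) \<sigma>0 \<sigma> \<and>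
    (mem \<sigma> ''h'' 0 < mem \<sigma> ''n'' 0 \<longrightarrow> mem \<sigma> ''j'' 0 = mem \<sigma>0 ''M'' 0))"
  unfolding search_loop_def
\<comment> \<open>Per slot 22 steps for the body and one for the test.\<close>
proof (rule ok_while[where m = "\<lambda>\<sigma>. mem \<sigma> ''M'' 0 - mem \<sigma> ''j'' 0" and
    I = "\<lambda>\<sigma>. searching \<sigma> \<and> eff search_vars (2 * mem \<sigma> ''j'' 0) (23 * mem \<sigma> ''j'' 0) \<sigma>0 \<sigma>"], goal_cases)
  case 1
  show ?case using assms by (simp add: eff_refl)
next
  case (2 \<sigma>)
  then have I: "searching (tick \<sigma>)" and e: "eff search_vars (2 * mem \<sigma> ''j'' 0) (23 * mem \<sigma> ''j'' 0) \<sigma>0 \<sigma>"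
    and b: "mem \<sigma> ''j'' 0 < mem \<sigma> ''M'' 0" "mem \<sigma> ''h'' 0 < mem \<sigma> ''n'' 0"
    by (simp_all add: searching_def)
  have t: "eff {} 0 1 \<sigma> (tick \<sigma>)" by (rule eff_local) auto
  have g: "gfun (tick \<sigma>) = gfun \<sigma>0"
    by (rule gfun_cong) (simp_all add: eff_mem[OF e] search_vars_def)
  show ?case
  proof (rule ok_mono[OF ok_search_step[OF I]], goal_cases)
    case (4 \<sigma>')
    then have e': "eff search_vars 2 22 (tick \<sigma>) \<sigma>'" and j: "mem \<sigma>' ''j'' 0 = Suc (mem \<sigma> ''j'' 0)" by auto
    have "eff search_vars (2 * mem \<sigma>' ''j'' 0) (23 * mem \<sigma>' ''j'' 0) \<sigma>0 \<sigma>'"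
      by (rule eff_trans[OF eff_trans[OF e t order.refl order.refl order.refl] e']) (simp_all add: j)
    moreover have "mem \<sigma>' ''M'' 0 = mem \<sigma> ''M'' 0"
      using eff_mem[OF e', of "''M''"] by (simp add: search_vars_def)
    ultimately show ?case using 4 b j by auto
  qed (use assms g b in simp_all)
next
  case (3 \<sigma>)
  then have I: "searching \<sigma>" and e: "eff search_vars (2 * mem \<sigma> ''j'' 0) (23 * mem \<sigma> ''j'' 0) \<sigma>0 \<sigma>"
    by auto
  have t: "eff {} 0 1 \<sigma> (tick \<sigma>)" by (rule eff_local) auto
  have M: "mem \<sigma> ''M'' = mem \<sigma>0 ''M''"
    by (simp add: eff_mem[OF e] search_vars_def)
  have j: "mem \<sigma> ''j'' 0 \<le> mem \<sigma>0 ''M'' 0"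
    using I by (simp add: searching_def M)
  have "eff search_vars (2 * mem \<sigma>0 ''M'' 0) (23 * mem \<sigma>0 ''M'' 0 + 1) \<sigma>0 (tick \<sigma>)"
    by (rule eff_trans[OF e t]) (use j in simp_all)
  then show ?case using 3 j by (auto simp: M searching_def)
qed

definition round_vars :: "vname set" where
  "round_vars = insert ''a'' (insert ''G'' (insert ''H'' (insert ''f'' (insert ''r'' search_vars))))"

lemma ok_start_search:
  assumes "mem \<sigma> ''s'' 0 = s" "\<And>x. mem \<sigma> ''A'' x \<le> mem \<sigma> ''a'' 0"
  shows "ok L start_search \<sigma> (\<lambda>\<sigma>'. searching \<sigma>' \<and> mem \<sigma>' ''j'' 0 = 0 \<and> gfun \<sigma>' = gfun \<sigma> \<and>
    eff (insert ''a'' search_vars) 0 7 \<sigma> \<sigma>')"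
proof -
  have A: "mem \<sigma> ''A'' x \<le> Suc (mem \<sigma> ''a'' 0)" "mem \<sigma> ''A'' x \<noteq> Suc (mem \<sigma> ''a'' 0)" for x
    using assms(2)[of x] by auto
  show ?thesis
    unfolding start_search_def
    by (auto simp: searching_def eff_def search_vars_def assms(1) A intro!: search_init[simplified] gfun_cong)
qed

lemma ok_search:
  assumes "mem \<sigma> ''s'' 0 = s" "\<And>x. mem \<sigma> ''A'' x \<le> mem \<sigma> ''a'' 0" "valid (gfun \<sigma>)" "mem \<sigma> ''M'' 0 = M"
  shows "ok L (Seq start_search (search_loop both)) \<sigma> (\<lambda>\<sigma>'. searching \<sigma>' \<and> gfun \<sigma>' = gfun \<sigma> \<and>
    eff (insert ''a'' search_vars) (2 * M) (23 * M + 8) \<sigma> \<sigma>' \<and>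
    (mem \<sigma>' ''h'' 0 < mem \<sigma>' ''n'' 0 \<longrightarrow> mem \<sigma>' ''j'' 0 = M))"
  unfolding ok_simps
proof (rule ok_mono[OF ok_start_search[OF assms(1,2)]], elim conjE, goal_cases)
  case (1 \<sigma>1)
  note e1 = 1(4)
  have M: "mem \<sigma>1 ''M'' 0 = M"
    using eff_mem[OF e1, of "''M''"] assms(4) by (simp add: search_vars_def)
  show ?case
  proof (rule ok_mono[OF ok_search_loop[OF 1(1)]], goal_cases)
    case (3 \<sigma>2)
    then have e2: "eff search_vars (2 * M) (23 * M + 1) \<sigma>1 \<sigma>2" unfolding M by blast
    have "gfun \<sigma>2 = gfun \<sigma>1"
      by (rule gfun_cong) (simp_all add: eff_mem[OF e2] search_vars_def)
    moreover have "eff (insert ''a'' search_vars) (2 * M) (23 * M + 8) \<sigma> \<sigma>2"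
      by (rule eff_trans[OF e1 e2]) auto
    ultimately show ?case using 3 1(3) M by simp
  qed (use 1 assms in simp_all)
qed

lemma ok_augment:
  assumes S: "search (gfun \<sigma>) (mem \<sigma> ''U'') (mem \<sigma> ''W'') (mem \<sigma> ''P'') (mem \<sigma> ''T'') n h i j"
    and "valid (gfun \<sigma>)" "\<And>w. mem \<sigma> ''H'' w \<le> mem \<sigma> ''e'' 0" "mem \<sigma> ''x'' 0 < j"
  shows "ok L augment \<sigma> (\<lambda>\<sigma>'. eff {''x'',''G'',''H''} 0 (4 * n + 2) \<sigma> \<sigma>' \<and> valid (gfun \<sigma>') \<and>
    (\<forall>w. mem \<sigma>' ''H'' w \<le> mem \<sigma> ''e'' 0) \<and>
    (\<forall>X. load (gfun \<sigma>') X \<le> load (gfun \<sigma>) X + 1) \<and>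
    (\<forall>X. s \<in> X \<and> mem \<sigma> ''U'' (mem \<sigma> ''T'' (mem \<sigma> ''x'' 0)) \<notin> X \<longrightarrow>
       load (gfun \<sigma>') X = load (gfun \<sigma>) X + 1))"
proof -
  let ?t = "mem \<sigma> ''T'' (mem \<sigma> ''x'' 0)"
  let ?aug = "augmenting (gfun \<sigma>) (mem \<sigma> ''U'') (mem \<sigma> ''W'') (mem \<sigma> ''P'') n ?t"
  have t: "?t < n" and s: "mem \<sigma> ''U'' 0 = s"
    using S assms(4) by (auto simp: search_def)
  \<comment> \<open>The cost is measured by the descent from \<open>?t\<close>: an iteration takes
    four steps and lowers \<open>x\<close> by at least one.\<close>
  let ?I = "\<lambda>\<sigma>'. ?aug (gfun \<sigma>') (mem \<sigma>' ''x'' 0) \<and> (\<forall>w. mem \<sigma>' ''H'' w \<le> mem \<sigma> ''e'' 0) \<and>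
    mem \<sigma>' ''x'' 0 \<le> ?t \<and> eff {''x'',''G'',''H''} 0 (1 + 4 * (?t - mem \<sigma>' ''x'' 0)) \<sigma> \<sigma>'"
  show ?thesis
    unfolding augment_def ok_simps
  proof (rule ok_while[where I = ?I and m = "\<lambda>\<sigma>. mem \<sigma> ''x'' 0"], goal_cases)
    case 1
    have "gfun (tick (store ''x'' 0 ?t \<sigma>)) = gfun \<sigma>"
      by (rule gfun_cong) simp_all
    then show ?case
      using augmenting_init[OF S assms(2) t] assms(3) by (simp add: eff_def)
  next
    case (2 \<sigma>')
    then have A: "?aug (gfun \<sigma>') (mem \<sigma>' ''x'' 0)" and H: "\<And>w. mem \<sigma>' ''H'' w \<le> mem \<sigma> ''e'' 0"
      and x: "mem \<sigma>' ''x'' 0 \<le> ?t" "0 < mem \<sigma>' ''x'' 0"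
      and e: "eff {''x'',''G'',''H''} 0 (1 + 4 * (?t - mem \<sigma>' ''x'' 0)) \<sigma> \<sigma>'"
      by auto
    note m = eff_mem[OF e]
    let ?x = "mem \<sigma>' ''x'' 0"
    define \<sigma>2 where "\<sigma>2 = tick (store ''x'' 0 (mem \<sigma> ''P'' ?x)
      (tick (store ''G'' (mem \<sigma> ''W'' ?x) (mem \<sigma> ''U'' (mem \<sigma> ''P'' ?x))
      (tick (store ''H'' (mem \<sigma> ''W'' ?x) (mem \<sigma> ''e'' 0) (tick \<sigma>'))))))"
    have g: "gfun \<sigma>2 = (gfun \<sigma>')(mem \<sigma> ''W'' ?x := mem \<sigma> ''U'' (mem \<sigma> ''P'' ?x))"
      by (rule ext) (simp add: \<sigma>2_def gfun_def m)
    have A2: "?aug (gfun \<sigma>2) (mem \<sigma>2 ''x'' 0)" "mem \<sigma>2 ''x'' 0 < ?x"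
      using augmenting_step[OF S A x(2)] by (simp_all add: g) (simp_all add: \<sigma>2_def)
    have "eff {''x'',''G'',''H''} 0 4 \<sigma>' \<sigma>2"
      by (rule eff_local) (simp_all add: \<sigma>2_def)
    from eff_trans[OF e this] have "eff {''x'',''G'',''H''} 0 (1 + 4 * (?t - mem \<sigma>2 ''x'' 0)) \<sigma> \<sigma>2"
      using A2(2) x by simp
    moreover have "mem \<sigma>2 ''H'' w \<le> mem \<sigma> ''e'' 0" for w
      using H by (simp add: \<sigma>2_def)
    ultimately have "?I \<sigma>2 \<and> mem \<sigma>2 ''x'' 0 < ?x" using A2 x by simp
    then show ?case by (simp add: \<sigma>2_def m)
  next
    case (3 \<sigma>')
    then have A: "?aug (gfun \<sigma>') 0" and H: "\<And>w. mem \<sigma>' ''H'' w \<le> mem \<sigma> ''e'' 0"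
      and e: "eff {''x'',''G'',''H''} 0 (1 + 4 * ?t) \<sigma> \<sigma>'"
      by auto
    have "eff {} 0 1 \<sigma>' (tick \<sigma>')" by (rule eff_local) auto
    from eff_trans[OF e this] have "eff {''x'',''G'',''H''} 0 (4 * n + 2) \<sigma> (tick \<sigma>')"
      using t by simp
    then show ?case
      using augmenting_final[OF A s] H by simp
  qed
qed

section \<open>Invariants of rounds and repetitions\<close>

definition result :: "nat \<Rightarrow> nat \<Rightarrow> state \<Rightarrow> bool" where
  "result k M \<sigma> \<longleftrightarrow> s \<in> returned_set \<sigma> \<and> vertex_out_component G k (returned_set \<sigma>) \<and>
     vol (returned_set \<sigma>) \<le> 2 * M"

text \<open>As long as nothing is found, \<open>n = 0\<close> keeps \<open>s\<close> out of the
  returned set; a returned \<open>s\<close> is thus always certified by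
  \<open>result\<close>.\<close>

definition rep_inv :: "nat \<Rightarrow> nat \<Rightarrow> state \<Rightarrow> bool" where
  "rep_inv k M \<sigma> \<longleftrightarrow> mem \<sigma> ''k'' 0 = k \<and> mem \<sigma> ''M'' 0 = M \<and> mem \<sigma> ''s'' 0 = s \<and>
     (\<forall>w. mem \<sigma> ''H'' w \<le> mem \<sigma> ''e'' 0) \<and> (\<forall>x. mem \<sigma> ''A'' x \<le> mem \<sigma> ''a'' 0) \<and>
     (if mem \<sigma> ''f'' 0 = 0 then mem \<sigma> ''n'' 0 = 0 else result k M \<sigma>)"

text \<open>The load of \<open>X\<close> starts at \<open>card X\<close> for the identity, and each
  augmentation adds at most one.\<close>

definition round_inv :: "nat \<Rightarrow> nat \<Rightarrow> state \<Rightarrow> bool" where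
  "round_inv k M \<sigma> \<longleftrightarrow> rep_inv k M \<sigma> \<and> valid (gfun \<sigma>) \<and>
     (\<forall>X\<subseteq>V. load (gfun \<sigma>) X \<le> card X + mem \<sigma> ''r'' 0)"

lemma returned_set_eq: "returned_set \<sigma> = mem \<sigma> ''U'' ` {..<mem \<sigma> ''n'' 0}"
  by (auto simp: returned_set_def)

lemma rep_inv_tick [simp]: "rep_inv k M (tick \<sigma>) = rep_inv k M \<sigma>"
  and round_inv_tick [simp]: "round_inv k M (tick \<sigma>) = round_inv k M \<sigma>"
  by (simp_all add: round_inv_def rep_inv_def result_def returned_set_eq)

lemma searching_result:
  assumes "searching \<sigma>" "valid (gfun \<sigma>)" "\<And>X. X \<subseteq> V \<Longrightarrow> load (gfun \<sigma>) X \<le> card X + k"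
    and "\<not> mem \<sigma> ''h'' 0 < mem \<sigma> ''n'' 0"
  shows "result k (mem \<sigma> ''M'' 0) \<sigma>"
proof -
  let ?n = "mem \<sigma> ''n'' 0" and ?X = "mem \<sigma> ''U'' ` {..<mem \<sigma> ''n'' 0}"
  have S: "search (gfun \<sigma>) (mem \<sigma> ''U'') (mem \<sigma> ''W'') (mem \<sigma> ''P'') (mem \<sigma> ''T'') ?n ?n (mem \<sigma> ''i'' 0) (mem \<sigma> ''j'' 0)"
    using assms(1,4) by (auto simp: searching_def search_def)
  have X: "?X \<subseteq> V" "s \<in> ?X" using S by (auto simp: search_def image_iff intro: bexI[of _ 0])
  have "vertex_out_component G k ?X"
    by (rule closed_component[OF X(1) _ search_finished[OF S] assms(3)[OF X(1)]]) (use X in auto)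
  then show ?thesis
    using search_vol[OF S] assms(1) X by (simp add: result_def returned_set_eq searching_def)
qed

lemma ok_conclude:
  assumes I: "searching \<sigma>" "valid (gfun \<sigma>)" "\<And>X. X \<subseteq> V \<Longrightarrow> load (gfun \<sigma>) X \<le> card X + r" "r \<le> k"
    and j: "mem \<sigma> ''h'' 0 < mem \<sigma> ''n'' 0 \<Longrightarrow> mem \<sigma> ''j'' 0 = M"
    and c: "mem \<sigma> ''k'' 0 = k" "mem \<sigma> ''M'' 0 = M" "mem \<sigma> ''s'' 0 = s" "\<And>w. mem \<sigma> ''H'' w \<le> mem \<sigma> ''e'' 0"
      "mem \<sigma> ''f'' 0 = 0" "1 \<le> M" "mem \<sigma> ''r'' 0 = r"
  shows "ok L (Seq conclude (Assign ''r'' (N 0) (Plus (S ''r'') (N 1)))) \<sigma>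
    (\<lambda>\<sigma>'. round_inv k M \<sigma>' \<and> mem \<sigma>' ''r'' 0 = Suc r \<and> eff round_vars 0 (4 * M + 10) \<sigma> \<sigma>')"
proof (cases "mem \<sigma> ''h'' 0 < mem \<sigma> ''n'' 0")
  case True
  let ?n = "mem \<sigma> ''n'' 0"
  have S: "search (gfun \<sigma>) (mem \<sigma> ''U'') (mem \<sigma> ''W'') (mem \<sigma> ''P'') (mem \<sigma> ''T'')
      ?n (mem \<sigma> ''h'' 0) (mem \<sigma> ''i'' 0) M" and n: "?n \<le> M + 1"
    and A: "\<And>x. mem \<sigma> ''A'' x \<le> mem \<sigma> ''a'' 0"
    using I(1) j[OF True] by (simp_all add: searching_def)
  have aug: "ok L augment (tick (store ''x'' 0 t (tick (store ''n'' 0 0 (tick \<sigma>)))))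
    (\<lambda>\<sigma>'. ok L (Assign ''r'' (N 0) (Plus (S ''r'') (N 1))) \<sigma>'
      (\<lambda>\<sigma>'. round_inv k M \<sigma>' \<and> mem \<sigma>' ''r'' 0 = Suc r \<and> eff round_vars 0 (4 * M + 10) \<sigma> \<sigma>'))"
    if "t \<le> M - 1" for t
  proof -
    define \<sigma>1 where "\<sigma>1 = tick (store ''x'' 0 t (tick (store ''n'' 0 0 (tick \<sigma>))))"
    have e1: "eff {''x'', ''n''} 0 3 \<sigma> \<sigma>1"
      by (rule eff_local) (simp_all add: \<sigma>1_def)
    have g1: "gfun \<sigma>1 = gfun \<sigma>"
      by (rule gfun_cong) (simp_all add: \<sigma>1_def)
    have S1: "search (gfun \<sigma>1) (mem \<sigma>1 ''U'') (mem \<sigma>1 ''W'') (mem \<sigma>1 ''P'') (mem \<sigma>1 ''T'')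
      ?n (mem \<sigma> ''h'' 0) (mem \<sigma> ''i'' 0) M"
      using S unfolding g1 by (simp add: \<sigma>1_def)
    have x1: "mem \<sigma>1 ''x'' 0 < M" using that c(6) by (simp add: \<sigma>1_def)
    have H1: "\<And>w. mem \<sigma>1 ''H'' w \<le> mem \<sigma>1 ''e'' 0" using c by (simp add: \<sigma>1_def)
    have n1: "mem \<sigma>1 ''n'' 0 = 0" by (simp add: \<sigma>1_def)
    show ?thesis
      unfolding \<sigma>1_def[symmetric]
    proof (rule ok_mono[OF ok_augment[OF S1 _ H1 x1]], goal_cases)
      case 1
      show ?case using I by (simp add: g1)
    next
      case (2 \<sigma>2)
      then have e2: "eff {''x'',''G'',''H''} 0 (4 * ?n + 2) \<sigma>1 \<sigma>2" and v: "valid (gfun \<sigma>2)"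
        and H2: "\<And>w. mem \<sigma>2 ''H'' w \<le> mem \<sigma>1 ''e'' 0"
        and l: "\<And>X. load (gfun \<sigma>2) X \<le> load (gfun \<sigma>) X + 1"
        by (auto simp: g1)
      note m = eff_mem[OF e1] eff_mem[OF e2]
      define \<sigma>3 where "\<sigma>3 = tick (store ''r'' 0 (Suc r) \<sigma>2)"
      have e3: "eff {''r''} 0 1 \<sigma>2 \<sigma>3"
        by (rule eff_local) (simp_all add: \<sigma>3_def)
      have g3: "gfun \<sigma>3 = gfun \<sigma>2"
        by (rule gfun_cong) (simp_all add: \<sigma>3_def)
      have "rep_inv k M \<sigma>3"
        using c A H2 n1 by (simp add: rep_inv_def m \<sigma>3_def)
      moreover have "load (gfun \<sigma>3) X \<le> card X + mem \<sigma>3 ''r'' 0" if "X \<subseteq> V" for X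
        using l[of X] I(3)[OF that] by (simp add: g3) (simp add: \<sigma>3_def)
      ultimately have "round_inv k M \<sigma>3"
        using v by (simp add: round_inv_def g3)
      moreover have "eff round_vars 0 (4 * M + 10) \<sigma> \<sigma>3"
        by (rule eff_trans[OF eff_trans[OF e1 e2 order.refl order.refl order.refl] e3])
           (use n in \<open>simp_all add: round_vars_def search_vars_def\<close>)
      moreover have "mem \<sigma>2 ''r'' 0 = r" using c by (simp add: m)
      ultimately show ?case by (simp add: \<sigma>3_def)
    qed
  qed
  then show ?thesis
    unfolding conclude_def using True c by simp
next
  case False
  define \<sigma>2 where "\<sigma>2 = tick (store ''r'' 0 (Suc r) (tick (store ''f'' 0 1 (tick \<sigma>))))"
  have e: "eff round_vars 0 (4 * M + 10) \<sigma> \<sigma>2"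
    by (rule eff_local) (auto simp: \<sigma>2_def round_vars_def)
  have g: "gfun \<sigma>2 = gfun \<sigma>"
    by (rule gfun_cong) (simp_all add: \<sigma>2_def)
  \<comment> \<open>The exhausted search certifies its queue, since \<open>r \<le> k\<close> keeps
    all loads within \<open>card X + k\<close>.\<close>
  have "result k M \<sigma>"
    using searching_result[OF I(1,2) _ False] I(3,4) c(2) by (meson add_left_mono order_trans)
  then have "result k M \<sigma>2"
    by (simp add: result_def returned_set_eq \<sigma>2_def)
  then have "rep_inv k M \<sigma>2"
    using c I(1) by (simp add: rep_inv_def searching_def \<sigma>2_def)
  moreover have "load (gfun \<sigma>) X \<le> card X + mem \<sigma>2 ''r'' 0" if "X \<subseteq> V" for X
    using I(3)[OF that] by (simp add: \<sigma>2_def)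
  ultimately have "round_inv k M \<sigma>2"
    using I by (simp add: round_inv_def g)
  then show ?thesis
    unfolding conclude_def using False e c by (simp add: \<sigma>2_def)
qed

lemma ok_round:
  assumes I: "round_inv k M \<sigma>" and f: "mem \<sigma> ''f'' 0 = 0" and r: "mem \<sigma> ''r'' 0 \<le> k" and "1 \<le> M"
  shows "ok L (search_round both) \<sigma> (\<lambda>\<sigma>'. round_inv k M \<sigma>' \<and> mem \<sigma>' ''r'' 0 = Suc (mem \<sigma> ''r'' 0) \<and>
    eff round_vars (2 * M) (27 * M + 18) \<sigma> \<sigma>')"
proof -
  have c: "mem \<sigma> ''s'' 0 = s" "\<And>x. mem \<sigma> ''A'' x \<le> mem \<sigma> ''a'' 0" "valid (gfun \<sigma>)" "mem \<sigma> ''M'' 0 = M"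
    "mem \<sigma> ''k'' 0 = k" "\<And>w. mem \<sigma> ''H'' w \<le> mem \<sigma> ''e'' 0"
    and l: "\<And>X. X \<subseteq> V \<Longrightarrow> load (gfun \<sigma>) X \<le> card X + mem \<sigma> ''r'' 0"
    using I by (auto simp: round_inv_def rep_inv_def)
  show ?thesis
    unfolding search_round_def ok_simps(6)[of _ "Seq start_search _"]
  proof (rule ok_mono[OF ok_search[OF c(1-4)]], elim conjE, goal_cases)
    case (1 \<sigma>1)
    note e1 = 1(3)
    note m1 = eff_mem[OF e1]
    show ?case
    proof (rule ok_mono[OF ok_conclude[OF 1(1) _ _ r, where M = M]], goal_cases)
      case (11 \<sigma>2)
      have "eff round_vars (2 * M) (27 * M + 18) \<sigma> \<sigma>2"
        by (rule eff_trans[OF e1, of round_vars 0 "4 * M + 10"]) (use 11 in \<open>auto simp: round_vars_def\<close>)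
      then show ?case using 11 by simp
    qed (use 1 c l f assms in \<open>auto simp: m1 search_vars_def\<close>)
  qed
qed

text \<open>
  Bounds the probability that the remaining rounds fail. The condition on the load says that all
  \<open>r\<close> augmentations so far ended outside \<open>C\<close>.
\<close>

definition pot :: "nat set \<Rightarrow> nat \<Rightarrow> nat \<Rightarrow> nat \<Rightarrow> state \<Rightarrow> ennreal" where
  "pot C k \<Delta> M \<sigma> = (if mem \<sigma> ''f'' 0 \<noteq> 0 then 0
     else if card C + mem \<sigma> ''r'' 0 \<le> load (gfun \<sigma>) C
       then ennreal (real (k - mem \<sigma> ''r'' 0) * (6 * real \<Delta> / real M))
     else 1)"

text \<open>The summand \<open>12 * \<Delta> * k\<close> of \<open>M\<close> is chosen for this:
  \<open>k\<close> rounds with failure probability \<open>6 * \<Delta> / M\<close> sum up to at most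
  one half.\<close>

lemma pot_le:
  assumes "M = 6 * \<Delta> + 1 + 12 * \<Delta> * k"
  shows "real k * (6 * real \<Delta> / real M) \<le> 1 / 2" "pot C k \<Delta> M \<sigma> \<le> 1"
proof -
  show *: "real k * (6 * real \<Delta> / real M) \<le> 1 / 2"
  proof -
    have "12 * \<Delta> * k \<le> M" "0 < M"
      unfolding assms by simp_all
    then have "real (12 * \<Delta> * k) \<le> real M" "0 < real M"
      unfolding of_nat_le_iff of_nat_0_less_iff .
    then show ?thesis by (simp add: field_simps)
  qed
  have "real (k - r) * (6 * real \<Delta> / real M) \<le> 1" for r
    using mult_right_mono[of "real (k - r)" "real k" "6 * real \<Delta> / real M"] * by simp
  then show "pot C k \<Delta> M \<sigma> \<le> 1"
    by (auto simp: pot_def ennreal_le_1)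
qed

lemma pot_tick [simp]: "pot C k \<Delta> M (tick \<sigma>) = pot C k \<Delta> M \<sigma>"
  unfolding pot_def by simp

text \<open>An augmentation fails to raise the load of \<open>C\<close> only if the random slot lies
  in \<open>C\<close>. The probability \<open>6 * \<Delta> / M\<close> allowed for this is the
  amount by which the good branch of \<open>pot\<close> falls when \<open>r < k\<close>
  increases.\<close>

lemma expect_round:
  assumes I: "round_inv k M \<sigma>" and f: "mem \<sigma> ''f'' 0 = 0" and r: "mem \<sigma> ''r'' 0 \<le> k"
    and M: "M = 6 * \<Delta> + 1 + 12 * \<Delta> * k" and C: "target k \<Delta> C"
  shows "expect L (search_round both) (pot C k \<Delta> M) \<sigma> \<le> pot C k \<Delta> M \<sigma>"
proof (cases "card C + mem \<sigma> ''r'' 0 \<le> load (gfun \<sigma>) C")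
  case False
  \<comment> \<open>Once the load lags behind, \<open>pot\<close> already has its maximal value
    1.\<close>
  have "expect L (search_round both) (pot C k \<Delta> M) \<sigma> \<le> 1"
    by (rule expect_le_const[OF ok_round[OF I f r]]) (use M pot_le(2)[OF M] in auto)
  then show ?thesis using False f by (simp add: pot_def)
next
  case True
  let ?r = "mem \<sigma> ''r'' 0"
  let ?a = "real (k - ?r) * (6 * real \<Delta> / real M)"
  let ?b = "real (k - Suc ?r) * (6 * real \<Delta> / real M)"
  let ?incr = "Assign ''r'' (N 0) (Plus (S ''r'') (N 1))"
  have M1: "1 \<le> M" using M by simp
  have c: "mem \<sigma> ''s'' 0 = s" "\<And>x. mem \<sigma> ''A'' x \<le> mem \<sigma> ''a'' 0" "valid (gfun \<sigma>)" "mem \<sigma> ''M'' 0 = M"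
    "mem \<sigma> ''k'' 0 = k" "\<And>w. mem \<sigma> ''H'' w \<le> mem \<sigma> ''e'' 0"
    using I by (auto simp: round_inv_def rep_inv_def)
  have sC: "s \<in> C" using C by (simp add: target_def)
  have "expect L (search_round both) (pot C k \<Delta> M) \<sigma> \<le> ennreal ?a"
    unfolding search_round_def
  proof (rule expect_Seq_le[OF ok_search[OF c(1-4)]], elim conjE, goal_cases)
    case (1 \<sigma>1)
    note e1 = 1(3)
    note m1 = eff_mem[OF e1]
    note g1 = 1(2)
    show ?case
    proof (cases "mem \<sigma>1 ''h'' 0 < mem \<sigma>1 ''n'' 0")
      case fin: False
      show ?thesis
        by (rule expect_le_const[where Q = "\<lambda>\<sigma>. mem \<sigma> ''f'' 0 = 1"])
           (use fin in \<open>simp_all add: conclude_def pot_def\<close>)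
    next
      case unfinished: True
      then have j: "mem \<sigma>1 ''j'' 0 = M" using 1 by simp
      let ?U = "mem \<sigma>1 ''U''" and ?T = "mem \<sigma>1 ''T''"
      have S: "search (gfun \<sigma>) ?U (mem \<sigma>1 ''W'') (mem \<sigma>1 ''P'') ?T
          (mem \<sigma>1 ''n'' 0) (mem \<sigma>1 ''h'' 0) (mem \<sigma>1 ''i'' 0) M"
        using 1(1) j g1 by (simp add: searching_def)
      \<comment> \<open>For \<open>r = k\<close> the load of \<open>C\<close> would reach
        \<open>card C + k\<close>, and no search could process \<open>M > 6 * \<Delta>\<close>
        slots.\<close>
      have "?r \<noteq> k"
        using search_finishes_in_target[OF S C c(3)] True M by auto
      then have rk: "Suc ?r \<le> k" using r by simp
      \<comment> \<open>A slot inside \<open>C\<close> is charged the maximal potential 1; any other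
        leaves at most \<open>?b\<close>.\<close>
      have step: "expect L augment (expect L ?incr (pot C k \<Delta> M))
            (tick (store ''x'' 0 t (tick (store ''n'' 0 0 (tick \<sigma>1)))))
          \<le> ennreal (of_bool (?U (?T t) \<in> C) + ?b)" if "t \<le> M - 1" for t
      proof -
        define \<sigma>2 where "\<sigma>2 = tick (store ''x'' 0 t (tick (store ''n'' 0 0 (tick \<sigma>1))))"
        have g2: "gfun \<sigma>2 = gfun \<sigma>"
          unfolding g1[symmetric] by (rule gfun_cong) (simp_all add: \<sigma>2_def)
        have S2: "search (gfun \<sigma>2) (mem \<sigma>2 ''U'') (mem \<sigma>2 ''W'') (mem \<sigma>2 ''P'') (mem \<sigma>2 ''T'')
            (mem \<sigma>1 ''n'' 0) (mem \<sigma>1 ''h'' 0) (mem \<sigma>1 ''i'' 0) M"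
          using S unfolding g2 by (simp add: \<sigma>2_def)
        have x2: "mem \<sigma>2 ''x'' 0 < M" using that M1 by (simp add: \<sigma>2_def)
        have H2: "\<And>w. mem \<sigma>2 ''H'' w \<le> mem \<sigma>2 ''e'' 0" using c by (simp add: \<sigma>2_def m1 search_vars_def)
        show ?thesis
          unfolding \<sigma>2_def[symmetric]
        proof (rule expect_le_const[OF ok_augment[OF S2 _ H2 x2]], goal_cases)
          case 1
          show ?case using c by (simp add: g2)
        next
          case (2 \<sigma>3)
          then have e3: "eff {''x'',''G'',''H''} 0 (4 * mem \<sigma>1 ''n'' 0 + 2) \<sigma>2 \<sigma>3"
            and "s \<in> C \<and> mem \<sigma>2 ''U'' (mem \<sigma>2 ''T'' (mem \<sigma>2 ''x'' 0)) \<notin> C \<longrightarrow>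
              load (gfun \<sigma>3) C = load (gfun \<sigma>) C + 1"
            by (simp_all add: g2)
          moreover have "mem \<sigma>2 ''U'' (mem \<sigma>2 ''T'' (mem \<sigma>2 ''x'' 0)) = ?U (?T t)"
            by (simp add: \<sigma>2_def)
          ultimately have l: "?U (?T t) \<notin> C \<Longrightarrow> load (gfun \<sigma>3) C = load (gfun \<sigma>) C + 1"
            using sC by metis
          have r3: "mem \<sigma>3 ''r'' 0 = ?r"
            by (simp add: eff_mem[OF e3]) (simp add: \<sigma>2_def m1 search_vars_def)
          define \<sigma>4 where "\<sigma>4 = tick (store ''r'' 0 (Suc ?r) \<sigma>3)"
          have g4: "gfun \<sigma>4 = gfun \<sigma>3"
            by (rule gfun_cong) (simp_all add: \<sigma>4_def)
          have "expect L ?incr (pot C k \<Delta> M) \<sigma>3 = pot C k \<Delta> M \<sigma>4"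
            by (simp add: expect_Assign r3 \<sigma>4_def)
          also have "\<dots> \<le> ennreal (of_bool (?U (?T t) \<in> C) + ?b)"
          proof (cases "?U (?T t) \<in> C")
            case True
            have "pot C k \<Delta> M \<sigma>4 \<le> ennreal 1" using pot_le(2)[OF M] by simp
            also have "\<dots> \<le> ennreal (of_bool (?U (?T t) \<in> C) + ?b)"
              using True by (intro ennreal_leI) simp
            finally show ?thesis .
          next
            case False
            have "mem \<sigma>4 ''r'' 0 = Suc ?r" by (simp add: \<sigma>4_def)
            then show ?thesis
              using l[OF False] True False unfolding pot_def g4 by simp
          qed
          finally show ?case .
        qed
      qed
      have sum: "(\<Sum>t\<le>M - 1. of_bool (?U (?T t) \<in> C) + ?b) \<le> 6 * real \<Delta> + real M * ?b"
      proof -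
        have "{..M - 1} = {..<M}" using M1 by auto
        then have "(\<Sum>t\<le>M - 1. of_bool (?U (?T t) \<in> C) + ?b) =
            real (card {t. t < M \<and> ?U (?T t) \<in> C}) + real M * ?b"
          by (simp add: sum.distrib of_bool_def sum.If_cases lessThan_def Int_def)
        then show ?thesis
          using search_target_slots[OF S C] by simp
      qed
      have M1': "mem \<sigma>1 ''M'' 0 = M" using c by (simp add: m1 search_vars_def)
      have "expect L (Seq conclude ?incr) (pot C k \<Delta> M) \<sigma>1 =
          (\<Sum>t\<le>M - 1. expect L augment (expect L ?incr (pot C k \<Delta> M))
            (tick (store ''x'' 0 t (tick (store ''n'' 0 0 (tick \<sigma>1)))))) / of_nat M"
        using unfinished M1 unfolding conclude_def
        by (simp add: expect_Seq expect_If expect_Rand expect_Assign M1' del: of_nat_Suc)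
      also have "\<dots> \<le> (\<Sum>t\<le>M - 1. ennreal (of_bool (?U (?T t) \<in> C) + ?b)) / of_nat M"
        by (intro divide_right_mono_ennreal sum_mono step) simp
      also have "\<dots> = ennreal (\<Sum>t\<le>M - 1. of_bool (?U (?T t) \<in> C) + ?b) / of_nat M"
        by (subst sum_ennreal) simp_all
      also have "\<dots> \<le> ennreal (6 * real \<Delta> + real M * ?b) / of_nat M"
        by (intro divide_right_mono_ennreal ennreal_leI sum)
      also have "\<dots> = ennreal ((6 * real \<Delta> + real M * ?b) / real M)"
        by (subst divide_ennreal[symmetric]) (use M1 in \<open>simp_all add: ennreal_of_nat_eq_real_of_nat\<close>)
      \<comment> \<open>\<open>Suc ?r \<le> k\<close> ensures that the subtraction in
        \<open>?b\<close> is not truncated.\<close>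
      also have "(6 * real \<Delta> + real M * ?b) / real M = ?a"
        using M1 rk by (simp add: field_simps of_nat_diff)
      finally show ?thesis .
    qed
  qed
  then show ?thesis using True f by (simp add: pot_def)
qed

lemma ok_rounds_step:
  assumes "round_inv k M \<sigma>" "mem \<sigma> ''f'' 0 = 0" "mem \<sigma> ''r'' 0 \<le> k" "1 \<le> M"
    and e: "eff round_vars (mem \<sigma> ''r'' 0 * (2 * M)) (mem \<sigma> ''r'' 0 * (27 * M + 19)) \<sigma>0 \<sigma>"
  shows "ok L (search_round both) (tick \<sigma>) (\<lambda>\<sigma>'. (round_inv k M \<sigma>' \<and> mem \<sigma>' ''r'' 0 \<le> k + 1 \<and>
      eff round_vars (mem \<sigma>' ''r'' 0 * (2 * M)) (mem \<sigma>' ''r'' 0 * (27 * M + 19)) \<sigma>0 \<sigma>') \<and>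
      k + 1 - mem \<sigma>' ''r'' 0 < k + 1 - mem \<sigma> ''r'' 0)"
proof -
  have t: "eff {} 0 1 \<sigma> (tick \<sigma>)" by (rule eff_local) auto
  have I: "round_inv k M (tick \<sigma>)"
    using assms(1) by simp
  show ?thesis
  proof (rule ok_mono[OF ok_round[OF I]], goal_cases)
    case (4 \<sigma>')
    then have "eff round_vars (mem \<sigma>' ''r'' 0 * (2 * M)) (mem \<sigma>' ''r'' 0 * (27 * M + 19)) \<sigma>0 \<sigma>'"
      by (intro eff_trans[OF eff_trans[OF e t order.refl order.refl order.refl], of _ "2 * M" "27 * M + 18"]) auto
    then show ?case using 4 assms by auto
  qed (use assms in auto)
qed

abbreviation "found \<sigma> \<equiv> mem \<sigma> ''f'' 0 \<noteq> 0"

lemma ok_rounds: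
  assumes "round_inv k M \<sigma>0" "mem \<sigma>0 ''r'' 0 = 0" "1 \<le> M"
  shows "ok L (rounds both) \<sigma>0 (\<lambda>\<sigma>. rep_inv k M \<sigma> \<and>
    eff round_vars ((k + 1) * (2 * M)) ((k + 1) * (27 * M + 19) + 1) \<sigma>0 \<sigma>)"
  unfolding rounds_def
proof (rule ok_while[where m = "\<lambda>\<sigma>. k + 1 - mem \<sigma> ''r'' 0" and I = "\<lambda>\<sigma>. round_inv k M \<sigma> \<and>
    mem \<sigma> ''r'' 0 \<le> k + 1 \<and> eff round_vars (mem \<sigma> ''r'' 0 * (2 * M)) (mem \<sigma> ''r'' 0 * (27 * M + 19)) \<sigma>0 \<sigma>"],
    goal_cases)
  case 1
  show ?case using assms by (simp add: eff_refl)
next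
  case (2 \<sigma>)
  then show ?case
    using assms(3) by (intro ok_rounds_step) (auto simp: round_inv_def rep_inv_def)
next
  case (3 \<sigma>)
  then have e: "eff round_vars (mem \<sigma> ''r'' 0 * (2 * M)) (mem \<sigma> ''r'' 0 * (27 * M + 19)) \<sigma>0 \<sigma>"
    and r: "mem \<sigma> ''r'' 0 \<le> k + 1" by auto
  have t: "eff {} 0 1 \<sigma> (tick \<sigma>)" by (rule eff_local) auto
  have "eff round_vars ((k + 1) * (2 * M)) ((k + 1) * (27 * M + 19) + 1) \<sigma>0 (tick \<sigma>)"
    by (rule eff_trans[OF e t]) (use mult_le_mono1[OF r, of "2 * M"] mult_le_mono1[OF r, of "27 * M + 19"] in simp_all)
  then show ?case
    using 3 by (simp add: round_inv_def)
qed

lemma expect_rounds: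
  assumes I: "round_inv k M \<sigma>0" "mem \<sigma>0 ''r'' 0 = 0" "mem \<sigma>0 ''f'' 0 = 0" "gfun \<sigma>0 = (\<lambda>w. w)"
    and M: "M = 6 * \<Delta> + 1 + 12 * \<Delta> * k" and C: "target k \<Delta> C"
  shows "expect L (rounds both) (\<lambda>\<sigma>. of_bool (\<not> found \<sigma>)) \<sigma>0 \<le> ennreal (1 / 2)"
proof -
  have M1: "1 \<le> M" using M by simp
  have "expect L (rounds both) (\<lambda>\<sigma>. of_bool (\<not> found \<sigma>)) \<sigma>0 \<le> pot C k \<Delta> M \<sigma>0"
    unfolding rounds_def
  proof (rule expect_while[where m = "\<lambda>\<sigma>. k + 1 - mem \<sigma> ''r'' 0" and I = "\<lambda>\<sigma>. round_inv k M \<sigma> \<and>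
    mem \<sigma> ''r'' 0 \<le> k + 1 \<and> eff round_vars (mem \<sigma> ''r'' 0 * (2 * M)) (mem \<sigma> ''r'' 0 * (27 * M + 19)) \<sigma>0 \<sigma>"],
    goal_cases)
    case 1
    show ?case using I by (simp add: eff_refl)
  next
    case (2 \<sigma>)
    then show ?case
      using M1 by (intro ok_rounds_step) (auto simp: round_inv_def rep_inv_def)
  next
    case (3 \<sigma>)
    then have "round_inv k M (tick \<sigma>)" "mem \<sigma> ''f'' 0 = 0" "mem \<sigma> ''r'' 0 \<le> k"
      by (auto simp: round_inv_def rep_inv_def)
    then show ?case
      using expect_round[OF _ _ _ M C, of "tick \<sigma>"] by simp
  next
    case (4 \<sigma>)
    show ?case
    proof (cases "found \<sigma>")
      case False
      \<comment> \<open>Loads never exceed \<open>card C + k\<close>, so after \<open>k + 1\<close>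
        unsuccessful rounds the potential is 1, matching the failure indicator.\<close>
      then have "mem \<sigma> ''r'' 0 = k + 1" "valid (gfun \<sigma>)"
        using 4 by (auto simp: round_inv_def rep_inv_def)
      then show ?thesis
        using target_load_le[OF _ C, of "gfun \<sigma>"] False by (simp add: pot_def)
    qed simp
  qed
  also have "\<dots> \<le> ennreal (1 / 2)"
  proof -
    \<comment> \<open>For the identity the load of \<open>C\<close> is \<open>card C\<close>, so the
      potential starts in its good branch with \<open>r = 0\<close>.\<close>
    have "C \<subseteq> V" using C by (simp add: target_def)
    then have "load (gfun \<sigma>0) C = card C" unfolding I(4) load_id by (simp add: Int_absorb1)
    then have "pot C k \<Delta> M \<sigma>0 = ennreal (real k * (6 * real \<Delta> / real M))"
      using I by (simp add: pot_def)
    then show ?thesis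
      using ennreal_leI[OF pot_le(1)[OF M]] by simp
  qed
  finally show ?thesis .
qed

section \<open>Repetitions and the success probability\<close>

definition cost :: "nat \<Rightarrow> nat \<Rightarrow> state \<Rightarrow> bool" where
  "cost q t \<sigma> \<longleftrightarrow> steps \<sigma> \<le> t \<and> length (queries \<sigma>) \<le> q \<and> set (queries \<sigma>) \<subseteq> legal_queries G"

lemma cost_eff: "cost q t \<sigma> \<Longrightarrow> eff X q' t' \<sigma> \<sigma>' \<Longrightarrow> cost (q + q') (t + t') \<sigma>'"
  by (auto simp: cost_def eff_def)

lemma cost_mono: "cost q t \<sigma> \<Longrightarrow> q \<le> q' \<Longrightarrow> t \<le> t' \<Longrightarrow> cost q' t' \<sigma>"
  by (auto simp: cost_def)

definition repetition :: com where
  "repetition = Seq (Assign ''e'' (N 0) (Plus (S ''e'') (N 1)))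
     (Seq (Assign ''r'' (N 0) (N 0))
     (Seq (RAssign ''y'' (RPlus (R ''y'') (R ''y''))) (rounds both)))"

definition next_rep :: "state \<Rightarrow> state" where
  "next_rep \<sigma> = tick ((tick (store ''r'' 0 0 (tick (store ''e'' 0 (Suc (mem \<sigma> ''e'' 0)) \<sigma>))))
     \<lparr>rmem := (rmem \<sigma>)(''y'' := rmem \<sigma> ''y'' + rmem \<sigma> ''y'')\<rparr>)"

lemma next_rep [simp]:
  "mem (next_rep \<sigma>) x = (if x = ''r'' then (mem \<sigma> x)(0 := 0) else if x = ''e'' then (mem \<sigma> x)(0 := Suc (mem \<sigma> ''e'' 0)) else mem \<sigma> x)"
  "rmem (next_rep \<sigma>) = (rmem \<sigma>)(''y'' := 2 * rmem \<sigma> ''y'')"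
  "queries (next_rep \<sigma>) = queries \<sigma>" "steps (next_rep \<sigma>) = steps \<sigma> + 3"
  by (simp_all add: next_rep_def)

lemma ok_repetition_iff: "ok L repetition \<sigma> Q \<longleftrightarrow> ok L (rounds both) (next_rep \<sigma>) Q"
  by (simp add: repetition_def next_rep_def)

lemma expect_repetition: "expect L repetition f \<sigma> = expect L (rounds both) f (next_rep \<sigma>)"
  by (simp add: repetition_def next_rep_def expect_Seq expect_Assign)

text \<open>Raising \<open>e\<close> outdates all stamps in \<open>H\<close>, which resets the map
  to the identity at constant cost.\<close>

lemma round_inv_next_rep:
  assumes "rep_inv k M \<sigma>"
  shows "round_inv k M (next_rep \<sigma>)" "gfun (next_rep \<sigma>) = (\<lambda>w. w)"
proof -
  have H: "mem \<sigma> ''H'' w \<le> mem \<sigma> ''e'' 0" for w using assms by (simp add: rep_inv_def)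
  then have "mem \<sigma> ''H'' w < Suc (mem \<sigma> ''e'' 0)" for w using le_imp_less_Suc by blast
  then show g: "gfun (next_rep \<sigma>) = (\<lambda>w. w)"
    by (simp add: gfun_def fun_eq_iff)
  have "result k M (next_rep \<sigma>) = result k M \<sigma>"
    by (simp add: result_def returned_set_eq)
  then have "rep_inv k M (next_rep \<sigma>)"
    using assms H by (simp add: rep_inv_def le_SucI)
  then show "round_inv k M (next_rep \<sigma>)"
    using valid_id by (auto simp: round_inv_def g load_id intro!: card_mono finite_subset_V)
qed

lemma ok_repetition:
  assumes "rep_inv k M \<sigma>" "1 \<le> M"
  shows "ok L repetition \<sigma> (\<lambda>\<sigma>'. rep_inv k M \<sigma>' \<and> mem \<sigma>' ''e'' 0 = Suc (mem \<sigma> ''e'' 0) \<and>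
    rmem \<sigma>' ''y'' = 2 * rmem \<sigma> ''y'' \<and>
    eff round_vars ((k + 1) * (2 * M)) ((k + 1) * (27 * M + 19) + 1) (next_rep \<sigma>) \<sigma>')"
  unfolding ok_repetition_iff
proof (rule ok_mono[OF ok_rounds[where k = k and M = M]], goal_cases)
  case (4 \<sigma>')
  then have e: "eff round_vars ((k + 1) * (2 * M)) ((k + 1) * (27 * M + 19) + 1) (next_rep \<sigma>) \<sigma>'"
    by blast
  have "mem \<sigma>' ''e'' = mem (next_rep \<sigma>) ''e''" "rmem \<sigma>' = rmem (next_rep \<sigma>)"
    using e by (simp_all add: eff_def round_vars_def search_vars_def)
  then show ?case using 4 by simp
qed (use assms round_inv_next_rep in simp_all)

text \<open>The 5 counts the final test of \<open>rounds\<close>, the three assignments before it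
  and the outer test.\<close>

definition unit_cost :: "nat \<Rightarrow> nat \<Rightarrow> nat" where
  "unit_cost k M = (k + 1) * (27 * M + 19) + 5"

text \<open>\<open>q\<close> stands for \<open>1 - p\<close>. The clause with \<open>e - 1\<close>
  remembers that the last repetition began with \<open>y < 1\<close>; it later bounds the number of
  repetitions.\<close>

definition outer_inv :: "nat \<Rightarrow> nat \<Rightarrow> real \<Rightarrow> nat \<Rightarrow> state \<Rightarrow> bool" where
  "outer_inv k M q t \<sigma> \<longleftrightarrow> rep_inv k M \<sigma> \<and> rmem \<sigma> ''y'' = 2 ^ mem \<sigma> ''e'' 0 * q \<and>
     (0 < mem \<sigma> ''e'' 0 \<longrightarrow> 2 ^ (mem \<sigma> ''e'' 0 - 1) * q < 1) \<and>
     cost (mem \<sigma> ''e'' 0 * ((k + 1) * (2 * M))) (t + mem \<sigma> ''e'' 0 * unit_cost k M) \<sigma>"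

lemma outer_step:
  assumes I: "outer_inv k M q t \<sigma>" and b: "rmem \<sigma> ''y'' < 1" and "1 \<le> M" and K: "1 \<le> 2 ^ K * q" "0 < q"
  shows "ok L repetition (tick \<sigma>) (\<lambda>\<sigma>'. outer_inv k M q t \<sigma>' \<and> K - mem \<sigma>' ''e'' 0 < K - mem \<sigma> ''e'' 0)"
proof -
  let ?e = "mem \<sigma> ''e'' 0"
  have y: "2 ^ ?e * q < 1" using I b by (simp add: outer_inv_def)
  \<comment> \<open>A repetition starts only while \<open>2 ^ e * q < 1\<close>, which makes
    \<open>K - e\<close> a strictly decreasing variant.\<close>
  have "?e < K"
  proof (rule ccontr)
    assume "\<not> ?e < K"
    then have "(2::real) ^ K * q \<le> 2 ^ ?e * q"
      using K by (intro mult_right_mono power_increasing) auto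
    then show False using y K(1) by linarith
  qed
  have "rep_inv k M (tick \<sigma>)" using I by (simp add: outer_inv_def)
  then show ?thesis
  proof (rule ok_mono[OF ok_repetition[OF _ \<open>1 \<le> M\<close>]], goal_cases)
    case (1 \<sigma>')
    have "cost (?e * ((k + 1) * (2 * M))) (t + ?e * unit_cost k M + 4) (next_rep (tick \<sigma>))"
      using I by (simp add: outer_inv_def cost_def)
    from cost_eff[OF this 1[THEN conjunct2, THEN conjunct2, THEN conjunct2]]
    have "cost (Suc ?e * ((k + 1) * (2 * M))) (t + Suc ?e * unit_cost k M) \<sigma>'"
      by (simp add: unit_cost_def algebra_simps)
    then show ?case
      using 1 I y \<open>?e < K\<close> by (simp add: outer_inv_def diff_less_mono2)
  qed
qed

lemma outer_tick: "outer_inv k M q t \<sigma> \<Longrightarrow> outer_inv k M q (t + 1) (tick \<sigma>)"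
  by (auto simp: outer_inv_def cost_def)

lemma ex_power_ge: "0 < q \<Longrightarrow> \<exists>K. 1 \<le> 2 ^ K * (q :: real)"
proof -
  assume "0 < q"
  obtain K where "1 / q < 2 ^ K" using real_arch_pow[of 2 "1 / q"] by auto
  then show ?thesis using \<open>0 < q\<close> by (intro exI[of _ K]) (simp add: field_simps)
qed

lemma repetitions_eq: "repetitions both = While (Conj (RLess (R ''y'') ROne) (Less (S ''f'') (N 1))) repetition"
  by (simp add: repetitions_def repetition_def)

lemma ok_repetitions:
  assumes "outer_inv k M q t \<sigma>0" "0 < q" "1 \<le> M"
  shows "ok L (repetitions both) \<sigma>0 (outer_inv k M q (t + 1))"
proof -
  obtain K where "1 \<le> 2 ^ K * q" using ex_power_ge[OF \<open>0 < q\<close>] ..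
  then show ?thesis
    unfolding repetitions_eq using assms
    by (intro ok_while[where I = "outer_inv k M q t" and m = "\<lambda>\<sigma>. K - mem \<sigma> ''e'' 0"] outer_step outer_tick) auto
qed

text \<open>\<open>y\<close> times the failure indicator is a supermartingale: \<open>y\<close>
  doubles, while failure survives a repetition with probability at most one half. It starts at
  \<open>q\<close>, and failure at the exit implies \<open>y \<ge> 1\<close>.\<close>

lemma expect_repetitions:
  assumes I: "outer_inv k M q t \<sigma>0" "0 < q" and M: "M = 6 * \<Delta> + 1 + 12 * \<Delta> * k" and C: "target k \<Delta> C"
    and f: "\<not> found \<sigma>0" "rmem \<sigma>0 ''y'' = q"
  shows "expect L (repetitions both) (\<lambda>\<sigma>. of_bool (\<not> found \<sigma>)) \<sigma>0 \<le> ennreal q"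
proof -
  have M1: "1 \<le> M" using M by simp
  obtain K where K: "1 \<le> 2 ^ K * q" using ex_power_ge[OF \<open>0 < q\<close>] ..
  let ?\<phi> = "\<lambda>\<sigma>. ennreal (rmem \<sigma> ''y'') * of_bool (\<not> found \<sigma>)"
  have "expect L (repetitions both) (\<lambda>\<sigma>. of_bool (\<not> found \<sigma>)) \<sigma>0 \<le> ?\<phi> \<sigma>0"
    unfolding repetitions_eq
  proof (rule expect_while[where I = "outer_inv k M q t" and m = "\<lambda>\<sigma>. K - mem \<sigma> ''e'' 0"], goal_cases)
    case 1
    show ?case by (rule I)
  next
    case (2 \<sigma>)
    then show ?case using outer_step[OF _ _ M1 K I(2)] by simp
  next
    case (3 \<sigma>)
    then have inv: "rep_inv k M (tick \<sigma>)" and nf: "\<not> found \<sigma>"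
      by (auto simp: outer_inv_def)
    let ?y = "rmem \<sigma> ''y''"
    have y0: "0 \<le> ?y" using 3 I(2) by (simp add: outer_inv_def)
    have "expect L repetition ?\<phi> (tick \<sigma>) \<le>
        expect L repetition (\<lambda>\<sigma>'. ennreal (2 * ?y) * of_bool (\<not> found \<sigma>')) (tick \<sigma>)"
      by (rule expect_mono[OF ok_repetition[OF inv M1]]) simp
    also have "\<dots> = ennreal (2 * ?y) * expect L repetition (\<lambda>\<sigma>'. of_bool (\<not> found \<sigma>')) (tick \<sigma>)"
      by (rule expect_cmult)
    also have "\<dots> \<le> ennreal (2 * ?y) * ennreal (1 / 2)"
      unfolding expect_repetition using round_inv_next_rep[OF inv] nf
      by (intro mult_left_mono expect_rounds[OF _ _ _ _ M C]) simp_all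
    also have "\<dots> = ennreal ?y"
      using y0 by (subst ennreal_mult[symmetric]) simp_all
    finally show ?case using nf by simp
  next
    case (4 \<sigma>)
    then have "\<not> found \<sigma> \<Longrightarrow> 1 \<le> rmem \<sigma> ''y''" by auto
    then show ?case using ennreal_leI[of 1 "rmem \<sigma> ''y''"] by auto
  qed
  then show ?thesis using f by simp
qed

section \<open>The whole program and its numerical bounds\<close>

definition slots :: "nat \<Rightarrow> nat \<Rightarrow> nat" where
  "slots k \<Delta> = 6 * \<Delta> + 1 + 12 * \<Delta> * k"

lemma ok_budget:
  assumes "mem \<sigma>0 ''Delta'' 0 = \<Delta>" "mem \<sigma>0 ''k'' 0 = k" "mem \<sigma>0 ''i'' 0 = 0"
  shows "ok L budget \<sigma>0 (\<lambda>\<sigma>. eff {''d'',''M'',''i''} 0 (3 * k + 4) \<sigma>0 \<sigma> \<and> mem \<sigma> ''M'' 0 = slots k \<Delta>)"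
  unfolding budget_def ok_simps
proof (rule ok_while[where m = "\<lambda>\<sigma>. k - mem \<sigma> ''i'' 0" and I = "\<lambda>\<sigma>. mem \<sigma> ''d'' 0 = 6 * \<Delta> \<and>
    mem \<sigma> ''i'' 0 \<le> k \<and> mem \<sigma> ''M'' 0 = slots (mem \<sigma> ''i'' 0) \<Delta> \<and>
    eff {''d'',''M'',''i''} 0 (3 * mem \<sigma> ''i'' 0 + 3) \<sigma>0 \<sigma>"], goal_cases)
  case 1
  show ?case using assms by (simp add: slots_def eff_def)
next
  case (2 \<sigma>)
  then have "mem \<sigma> ''k'' = mem \<sigma>0 ''k''" by (auto intro: eff_mem)
  then show ?case using 2 assms by (auto simp: slots_def eff_def)
next
  case (3 \<sigma>)
  then have "mem \<sigma> ''k'' = mem \<sigma>0 ''k''" by (auto intro: eff_mem)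
  then have "mem \<sigma> ''i'' 0 = k" using 3 assms by auto
  then show ?case using 3 by (auto simp: eff_def)
qed

lemma ok_prefix:
  assumes "p < 1"
  shows "ok L (Seq budget (RAssign ''y'' (RMinus ROne (R ''p'')))) (init k \<Delta> p s) (\<lambda>\<sigma>.
    outer_inv k (slots k \<Delta>) (1 - p) (3 * k + 5) \<sigma> \<and> \<not> found \<sigma> \<and> rmem \<sigma> ''y'' = 1 - p)"
  unfolding ok_simps
proof (rule ok_mono[OF ok_budget[where k = k and \<Delta> = \<Delta>]], goal_cases)
  case (4 \<sigma>)
  then have e: "eff {''d'',''M'',''i''} 0 (3 * k + 4) (init k \<Delta> p s) \<sigma>" and M: "mem \<sigma> ''M'' 0 = slots k \<Delta>"
    by auto
  have "cost 0 0 (init k \<Delta> p s)" by (simp add: cost_def init_def)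
  from cost_eff[OF this e] have "cost 0 (3 * k + 4) \<sigma>" by simp
  moreover have "rmem \<sigma> = rmem (init k \<Delta> p s)" using e by (simp add: eff_def)
  ultimately show ?case
    using M by (simp add: outer_inv_def rep_inv_def eff_mem[OF e] cost_def) (simp add: init_def)
qed (simp_all add: init_def)

lemma ok_program:
  assumes "p < 1"
  shows "ok L (program both) (init k \<Delta> p s) (outer_inv k (slots k \<Delta>) (1 - p) (3 * k + 5 + 1))"
proof -
  have "ok L (Seq (Seq budget (RAssign ''y'' (RMinus ROne (R ''p'')))) (repetitions both)) (init k \<Delta> p s)
      (outer_inv k (slots k \<Delta>) (1 - p) (3 * k + 5 + 1))"
    unfolding ok_simps(6)[of _ "Seq _ _"]
  proof (rule ok_mono[OF ok_prefix[OF assms]], goal_cases)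
    case (1 \<sigma>)
    then show ?case
      using assms by (intro ok_repetitions) (auto simp: slots_def)
  qed
  then show ?thesis by (simp add: program_def)
qed

lemma expect_program:
  assumes "p < 1" "target k \<Delta> C"
  shows "expect L (program both) (\<lambda>\<sigma>. of_bool (\<not> found \<sigma>)) (init k \<Delta> p s) \<le> ennreal (1 - p)"
proof -
  have "expect L (Seq (Seq budget (RAssign ''y'' (RMinus ROne (R ''p'')))) (repetitions both))
      (\<lambda>\<sigma>. of_bool (\<not> found \<sigma>)) (init k \<Delta> p s) \<le> ennreal (1 - p)"
  proof (rule expect_Seq_le[OF ok_prefix[OF assms(1)]], goal_cases)
    case (1 \<sigma>)
    then show ?case
      using expect_repetitions[OF _ _ slots_def assms(2), of "1 - p" "3 * k + 5" \<sigma>] assms(1) by simp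
  qed
  then show ?thesis by (simp add: program_def expect_Seq[abs_def])
qed

text \<open>The last repetition began with \<open>2 ^ (e - 1) * (1 - p) < 1\<close>. Using
  \<open>ln 2 \<ge> 1 / 2\<close>, this gives \<open>e \<le> 1 + 2 * log_factor p\<close>, and
  \<open>1 \<le> log_factor p\<close> absorbs the 1.\<close>

lemma repetitions_bound:
  assumes "outer_inv k M (1 - p) t \<sigma>" "p < 1"
  shows "mem \<sigma> ''e'' 0 \<le> nat \<lfloor>3 * log_factor p\<rfloor>"
proof (cases "mem \<sigma> ''e'' 0")
  case (Suc e)
  then have "2 ^ e * (1 - p) < 1" using assms by (simp add: outer_inv_def)
  then have "2 ^ e < 1 / (1 - p)" using assms(2) by (simp add: field_simps)
  then have "ln (2 ^ e) \<le> ln (1 / (1 - p))" using assms(2) by (subst ln_le_cancel_iff) auto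
  then have "real e * ln 2 \<le> log_factor p" by (simp add: ln_realpow log_factor_def)
  moreover have "real e * (1 / 2) \<le> real e * ln 2"
    using ln2_ge_two_thirds by (intro mult_left_mono) auto
  moreover have "1 \<le> log_factor p" by (simp add: log_factor_def)
  ultimately show ?thesis using Suc by (intro le_nat_floor) simp
qed simp

lemma slots_le: "1 \<le> \<Delta> \<Longrightarrow> slots k \<Delta> \<le> 12 * (\<Delta> * (k + 1))"
  by (simp add: slots_def)

lemma bounds:
  assumes "1 \<le> \<Delta>" and e: "e \<le> nat \<lfloor>3 * log_factor p\<rfloor>"
  shows "real (e * ((k + 1) * (2 * slots k \<Delta>))) \<le> 144 * ((real k ^ 2 + 1) * real \<Delta> * log_factor p)"
    "real (3 * k + 6 + e * unit_cost k (slots k \<Delta>)) \<le> 2097 * ((real k ^ 2 + 1) * real \<Delta> * log_factor p)"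
proof -
  have lf: "1 \<le> log_factor p" by (simp add: log_factor_def)
  have e': "real e \<le> 3 * log_factor p"
  proof -
    have "real e \<le> real (nat \<lfloor>3 * log_factor p\<rfloor>)" using e by simp
    also have "\<dots> \<le> 3 * log_factor p" using lf by (intro of_nat_floor) simp
    finally show ?thesis .
  qed
  have sq: "(real k + 1) ^ 2 \<le> 2 * (real k ^ 2 + 1)"
    using sum_squares_bound[of "real k" 1] by (simp add: power2_sum)
  let ?D = "real \<Delta> * (real k + 1) ^ 2"
  have D: "?D \<le> 2 * ((real k ^ 2 + 1) * real \<Delta>)"
    using mult_left_mono[OF sq, of "real \<Delta>"] by (simp add: algebra_simps)
  have slots: "(k + 1) * slots k \<Delta> \<le> 12 * (\<Delta> * (k + 1) ^ 2)"
    using mult_left_mono[OF slots_le[OF assms(1), of k], of "k + 1"] by (simp add: power2_eq_square algebra_simps)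
  have k1: "k + 1 \<le> \<Delta> * (k + 1) ^ 2"
    using mult_mono[OF assms(1), of "k + 1" "(k + 1) ^ 2"] by (simp add: power2_eq_square)
  \<comment> \<open>The factor 6 is 3 from the number of repetitions times 2 from replacing
    \<open>(k + 1) ^ 2\<close> by \<open>k ^ 2 + 1\<close>.\<close>
  have main: "real (e * x) \<le> 6 * real c * ((real k ^ 2 + 1) * real \<Delta> * log_factor p)"
    if x: "x \<le> c * (\<Delta> * (k + 1) ^ 2)" for x c
  proof -
    have "real x \<le> real c * ?D"
    proof -
      have "real x \<le> real (c * (\<Delta> * (k + 1) ^ 2))" using x unfolding of_nat_le_iff .
      then show ?thesis by (simp add: add.commute)
    qed
    also have "\<dots> \<le> real c * (2 * ((real k ^ 2 + 1) * real \<Delta>))"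
      using D by (rule mult_left_mono) simp
    finally have "real e * real x \<le> (3 * log_factor p) * (real c * (2 * ((real k ^ 2 + 1) * real \<Delta>)))"
      using e' by (intro mult_mono) auto
    then show ?thesis by (simp add: algebra_simps)
  qed
  show "real (e * ((k + 1) * (2 * slots k \<Delta>))) \<le> 144 * ((real k ^ 2 + 1) * real \<Delta> * log_factor p)"
    using main[of "(k + 1) * (2 * slots k \<Delta>)" 24] slots by simp
  \<comment> \<open>\<open>348 = 27 * 12 + 19 + 5\<close>, with 12 from the bound on
    \<open>slots\<close>.\<close>
  have "unit_cost k (slots k \<Delta>) \<le> 348 * (\<Delta> * (k + 1) ^ 2)"
    using slots k1 by (simp add: unit_cost_def add_mult_distrib2 mult.left_commute del: power2_eq_square)
  then have 1: "real (e * unit_cost k (slots k \<Delta>)) \<le> 2088 * ((real k ^ 2 + 1) * real \<Delta> * log_factor p)"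
    using main[of "unit_cost k (slots k \<Delta>)" 348] by simp
  have "real (3 * k + 6) \<le> 9 * ((real k ^ 2 + 1) * 1 * 1)"
  proof -
    have "2 * real k \<le> (real k)\<^sup>2 + 1" using sum_squares_bound[of "real k" 1] by simp
    moreover have "0 \<le> (real k)\<^sup>2" by simp
    ultimately have "3 * real k \<le> 3 + 9 * (real k)\<^sup>2" by linarith
    then show ?thesis by simp
  qed
  also have "\<dots> \<le> 9 * ((real k ^ 2 + 1) * real \<Delta> * log_factor p)"
    using assms(1) lf by (intro mult_left_mono mult_mono) auto
  finally show "real (3 * k + 6 + e * unit_cost k (slots k \<Delta>)) \<le> 2097 * ((real k ^ 2 + 1) * real \<Delta> * log_factor p)"
    using 1 by simp
qed

lemma program_correct:
  assumes "1 \<le> \<Delta>" "p < 1"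
  shows "lossless_spmf (run (program both) L k \<Delta> p s)"
    and "\<sigma> \<in> set_spmf (run (program both) L k \<Delta> p s) \<Longrightarrow>
      real (length (queries \<sigma>)) \<le> 144 * ((real k ^ 2 + 1) * real \<Delta> * log_factor p)"
    and "vertex_out_component G k C \<Longrightarrow> s \<in> C \<Longrightarrow> vol C \<le> \<Delta> \<Longrightarrow>
      p \<le> measure (measure_spmf (run (program both) L k \<Delta> p s)) {\<sigma>. {s} \<subseteq> returned_set \<sigma>}"
    and "\<sigma> \<in> set_spmf (run (program both) L k \<Delta> p s) \<Longrightarrow> {s} \<subseteq> returned_set \<sigma> \<Longrightarrow>
      vertex_out_component G k (returned_set \<sigma>) \<and>
      real (vol (returned_set \<sigma>)) \<le> 144 * ((real k + 1) * (real \<Delta> + real k))"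
    and "expected_query_time_le G \<tau> M \<Longrightarrow> expected_time M (run (program both) L k \<Delta> p s)
      \<le> ennreal ((2097 + 144 * max 0 \<tau>) * ((real k ^ 2 + 1) * (real \<Delta> + real k) * log_factor p))"
proof -
  let ?run = "run (program both) L k \<Delta> p s" and ?M = "slots k \<Delta>"
  let ?E = "nat \<lfloor>3 * log_factor p\<rfloor>"
  let ?a = "?E * ((k + 1) * (2 * ?M))" and ?b = "3 * k + 6 + ?E * unit_cost k ?M"
  let ?B = "(real k ^ 2 + 1) * real \<Delta> * log_factor p"
  have inv: "outer_inv k ?M (1 - p) (3 * k + 5 + 1) \<sigma>" if "\<sigma> \<in> set_spmf ?run" for \<sigma>
    using ok_program[OF assms(2)] that unfolding ok_def run_def by blast
  have res: "if found \<sigma> then result k ?M \<sigma> else mem \<sigma> ''n'' 0 = 0" if "\<sigma> \<in> set_spmf ?run" for \<sigma>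
    using inv[OF that] by (simp add: outer_inv_def rep_inv_def split: if_splits)
  have cost: "cost ?a ?b \<sigma>" if "\<sigma> \<in> set_spmf ?run" for \<sigma>
  proof -
    have le: "mem \<sigma> ''e'' 0 \<le> ?E" using repetitions_bound[OF inv[OF that] assms(2)] .
    have "cost (mem \<sigma> ''e'' 0 * ((k + 1) * (2 * ?M))) (3 * k + 5 + 1 + mem \<sigma> ''e'' 0 * unit_cost k ?M) \<sigma>"
      using inv[OF that] unfolding outer_inv_def by blast
    then show ?thesis
      by (rule cost_mono) (use mult_le_mono1[OF le, of "unit_cost k ?M"] in \<open>auto intro!: mult_le_mono1 le\<close>)
  qed
  show lossless: "lossless_spmf ?run"
    using ok_program[OF assms(2)] by (simp add: ok_def run_def)
  show "real (length (queries \<sigma>)) \<le> 144 * ?B" if "\<sigma> \<in> set_spmf ?run" for \<sigma>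
  proof -
    have "real (length (queries \<sigma>)) \<le> real ?a"
      using cost[OF that] unfolding cost_def of_nat_le_iff by blast
    also have "\<dots> \<le> 144 * ?B" by (rule bounds(1)[OF assms(1) order.refl])
    finally show ?thesis .
  qed
  show "p \<le> measure (measure_spmf ?run) {\<sigma>. {s} \<subseteq> returned_set \<sigma>}"
    if C: "vertex_out_component G k C" "s \<in> C" "vol C \<le> \<Delta>"
  proof -
    let ?A = "{\<sigma>. {s} \<subseteq> returned_set \<sigma>}" and ?N = "{\<sigma>. \<not> found \<sigma>}"
    \<comment> \<open>\<open>C\<close> itself may have too many vertices without outgoing edges, so
      the analysis runs with a target instead.\<close>
    obtain C' where "target k \<Delta> C'" using ex_target[OF C assms(1)] ..
    then have "(\<integral>\<^sup>+ \<sigma>. of_bool (\<not> found \<sigma>) \<partial>measure_spmf ?run) \<le> ennreal (1 - p)"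
      using expect_program[OF assms(2)] by (simp add: expect_def run_def)
    also have "(\<lambda>\<sigma>. of_bool (\<not> found \<sigma>)) = (indicator ?N :: state \<Rightarrow> ennreal)"
      by (auto simp: indicator_def fun_eq_iff)
    finally have "emeasure (measure_spmf ?run) ?N \<le> ennreal (1 - p)" by simp
    then have N: "measure (measure_spmf ?run) ?N \<le> 1 - p"
      using assms(2) by (simp add: measure_spmf.emeasure_eq_measure)
    have "1 = measure (measure_spmf ?run) UNIV"
      using lossless by (simp add: lossless_spmf_def weight_spmf_def)
    \<comment> \<open>By \<open>res\<close>, every run that is not a failure returns a set
      containing \<open>s\<close>.\<close>
    also have "\<dots> \<le> measure (measure_spmf ?run) (?A \<union> ?N)"
      by (rule measure_spmf.finite_measure_mono_AE, use res in \<open>force simp: result_def\<close>, simp)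
    also have "\<dots> \<le> measure (measure_spmf ?run) ?A + measure (measure_spmf ?run) ?N"
      by (rule measure_Un_le) auto
    finally show ?thesis using N by simp
  qed
  show "vertex_out_component G k (returned_set \<sigma>) \<and>
      real (vol (returned_set \<sigma>)) \<le> 144 * ((real k + 1) * (real \<Delta> + real k))"
    if "\<sigma> \<in> set_spmf ?run" "{s} \<subseteq> returned_set \<sigma>" for \<sigma>
  proof -
    \<comment> \<open>Failed runs have \<open>n = 0\<close> and return the empty set.\<close>
    have res: "result k ?M \<sigma>"
      using that(2) res[OF that(1)] by (cases "found \<sigma>") (auto simp: returned_set_eq)
    then have "vol (returned_set \<sigma>) \<le> 24 * (\<Delta> * (k + 1))"
      using slots_le[OF assms(1), of k] by (simp add: result_def)
    then have "real (vol (returned_set \<sigma>)) \<le> real (24 * (\<Delta> * (k + 1)))"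
      unfolding of_nat_le_iff .
    also have "\<dots> = 24 * ((real k + 1) * real \<Delta>)" by (simp add: algebra_simps)
    also have "\<dots> \<le> 144 * ((real k + 1) * (real \<Delta> + real k))"
      by (intro mult_mono) auto
    finally show ?thesis using res by (simp add: result_def)
  qed
  show "expected_time M ?run
      \<le> ennreal ((2097 + 144 * max 0 \<tau>) * ((real k ^ 2 + 1) * (real \<Delta> + real k) * log_factor p))"
    if "expected_query_time_le G \<tau> M"
  proof -
    have "expected_time M ?run \<le> of_nat ?b + of_nat ?a * ennreal \<tau>"
      by (rule expected_time_le[OF that]) (use cost in \<open>unfold cost_def, blast\<close>)
    \<comment> \<open>For negative \<open>\<tau>\<close> the value \<open>ennreal \<tau>\<close> is
      0, hence \<open>max 0 \<tau>\<close>.\<close>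
    also have "\<dots> = ennreal (real ?b + real ?a * max 0 \<tau>)"
      by (simp add: ennreal_of_nat_eq_real_of_nat ennreal_plus[symmetric] ennreal_mult[symmetric] max_def ennreal_neg
        del: ennreal_plus of_nat_add of_nat_mult)
    also have "\<dots> \<le> ennreal ((2097 + 144 * max 0 \<tau>) * ?B)"
    proof (rule ennreal_leI)
      have "real ?b + real ?a * max 0 \<tau> \<le> 2097 * ?B + (144 * ?B) * max 0 \<tau>"
        by (intro add_mono mult_right_mono bounds[OF assms(1) order.refl]) simp
      then show "real ?b + real ?a * max 0 \<tau> \<le> (2097 + 144 * max 0 \<tau>) * ?B"
        by (simp add: algebra_simps)
    qed
    also have "\<dots> \<le> ennreal ((2097 + 144 * max 0 \<tau>) * ((real k ^ 2 + 1) * (real \<Delta> + real k) * log_factor p))"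
      by (intro ennreal_leI mult_left_mono mult_right_mono) (auto simp: log_factor_def)
    finally show ?thesis .
  qed
qed

end

theorem theorem5:
  shows "\<forall>vol \<in> {volume, sym_volume}. \<exists>P :: com.
    (\<exists>c :: real. \<forall>(k :: nat) (\<Delta> :: nat) (p :: real) (G :: nat pair_pre_digraph) L s.
       1 \<le> \<Delta> \<and> p < 1 \<and> pair_fin_digraph G \<and> incidence_lists G L \<and> s \<in> pverts G \<longrightarrow>
       lossless_spmf (run P L k \<Delta> p s) \<and>
       (\<forall>\<sigma> \<in> set_spmf (run P L k \<Delta> p s).
          real (length (queries \<sigma>)) \<le> c * ((real k ^ 2 + 1) * real \<Delta> * log_factor p)) \<and>
       ((\<exists>C. vertex_out_component G k C \<and> s \<in> C \<and> vol G C \<le> \<Delta>) \<longrightarrow>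
          measure (measure_spmf (run P L k \<Delta> p s)) {\<sigma>. {s} \<subseteq> returned_set \<sigma>} \<ge> p) \<and>
       (\<forall>\<sigma> \<in> set_spmf (run P L k \<Delta> p s). {s} \<subseteq> returned_set \<sigma> \<longrightarrow>
          vertex_out_component G k (returned_set \<sigma>) \<and>
          real (vol G (returned_set \<sigma>)) \<le> c * ((real k + 1) * (real \<Delta> + real k)))) \<and>
    (\<forall>\<tau> :: real. \<exists>c :: real. \<forall>(k :: nat) (\<Delta> :: nat) (p :: real) (G :: nat pair_pre_digraph) L s M.
       1 \<le> \<Delta> \<and> p < 1 \<and> pair_fin_digraph G \<and> incidence_lists G L \<and> s \<in> pverts G \<and>
       expected_query_time_le G \<tau> M \<longrightarrow>
       expected_time M (run P L k \<Delta> p s)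
         \<le> ennreal (c * ((real k ^ 2 + 1) * (real \<Delta> + real k) * log_factor p)))"
proof (rule ballI, goal_cases)
  case (1 vol)
  \<comment> \<open>One parametrized program covers both notions of volume; \<open>both\<close>
    picks the variant fitting \<open>vol\<close>.\<close>
  define both where "both \<longleftrightarrow> vol \<noteq> volume"
  have lg: "listed_graph G L s"
    if "pair_fin_digraph G" "incidence_lists G L" "s \<in> pverts G" for G L s
    using that by (simp add: listed_graph_def)
  have vol: "listed_graph.vol G both = vol G" if "listed_graph G L s" for G L s
    using 1 by (auto simp: listed_graph.vol_def[OF that] both_def)
  show ?case
  proof (intro exI[of _ "program both"] conjI allI)
    show "\<exists>c :: real. \<forall>k \<Delta> p G L s.
       1 \<le> \<Delta> \<and> p < 1 \<and> pair_fin_digraph G \<and> incidence_lists G L \<and> s \<in> pverts G \<longrightarrow>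
       lossless_spmf (run (program both) L k \<Delta> p s) \<and>
       (\<forall>\<sigma> \<in> set_spmf (run (program both) L k \<Delta> p s).
          real (length (queries \<sigma>)) \<le> c * ((real k ^ 2 + 1) * real \<Delta> * log_factor p)) \<and>
       ((\<exists>C. vertex_out_component G k C \<and> s \<in> C \<and> vol G C \<le> \<Delta>) \<longrightarrow>
          measure (measure_spmf (run (program both) L k \<Delta> p s)) {\<sigma>. {s} \<subseteq> returned_set \<sigma>} \<ge> p) \<and>
       (\<forall>\<sigma> \<in> set_spmf (run (program both) L k \<Delta> p s). {s} \<subseteq> returned_set \<sigma> \<longrightarrow>
          vertex_out_component G k (returned_set \<sigma>) \<and>
          real (vol G (returned_set \<sigma>)) \<le> c * ((real k + 1) * (real \<Delta> + real k)))"
    \<comment> \<open>The constant 144 of the query bound also covers the volume bound, whose own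
      constant is 24.\<close>
    proof (intro exI[of _ 144] allI impI, elim conjE, goal_cases)
      case (1 k \<Delta> p G L s)
      note lg = lg[OF 1(3-5)]
      note correct = listed_graph.program_correct[OF lg 1(1,2), where both = both, unfolded vol[OF lg]]
      show ?case using correct(1-4) by blast
    qed
    show "\<exists>c :: real. \<forall>k \<Delta> p G L s M.
       1 \<le> \<Delta> \<and> p < 1 \<and> pair_fin_digraph G \<and> incidence_lists G L \<and> s \<in> pverts G \<and>
       expected_query_time_le G \<tau> M \<longrightarrow>
       expected_time M (run (program both) L k \<Delta> p s)
         \<le> ennreal (c * ((real k ^ 2 + 1) * (real \<Delta> + real k) * log_factor p))" for \<tau> :: real
      using listed_graph.program_correct(5)[OF lg] by (intro exI[of _ "2097 + 144 * max 0 \<tau>"]) blast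
  qed
qed

end
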